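(* Let $\mathcal V$ be an integral commutative quantale. For a $\mathcal V\text{-}\mathsf{cat}$-functor $G:\mathcal V\text{-}\mathsf{cat}\to\mathcal V\text{-}\mathsf{cat}$ the following are equivalent: (1) There exists a functor $H:\mathsf{Set}\to\mathcal V\text{-}\mathsf{cat}$ such that $G\cong\mathrm{Lan}_DH$, the $\mathcal V\text{-}\mathsf{cat}$-enriched left Kan extension of $H$ along the discrete functor $D:\mathsf{Set}\to\mathcal V\text{-}\mathsf{cat}$. (2) $G$ preserves the colimits of all diagrams $(N,DF_{\mathcal X})$, for $\mathcal X$ a small $\mathcal V$-category.
   Context: $\mathcal V=(\mathcal V_o,\otimes,e,[-,-])$ is a commutative quantale: a complete lattice with a commutative, associative, monotone operation $\otimes$ with unit $e$, such that each $-\otimes r$ has a right adjoint $[r,-]$; it is assumed non-trivial ($e\neq\bot$), and it is integral if $e=\top$. A (small) $\mathcal V$-category $\mathcal X$ is a set of objects together with elements $\mathcal X(x',x)\in\mathcal V_o$ satisfying $e\le\mathcal X(x,x)$ and $\mathcal X(x',x)\otimes\mathcal X(x'',x')\le\mathcal X(x'',x)$; a $\mathcal V$-functor $f:\mathcal X\to\mathcal Y$ is a map on objects with $\mathcal X(x',x)\le\mathcal Y(fx',fx)$. $\mathcal V\text{-}\mathsf{cat}$ is the symmetric monoidal closed category of small $\mathcal V$-categories and $\mathcal V$-functors, with $(\mathcal X\otimes\mathcal Y)((x',y'),(x,y))=\mathcal X(x',x)\otimes\mathcal Y(y',y)$, unit $\mathbb 1$ (one object $0$ with $\mathbb 1(0,0)=e$),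 and internal hom $[\mathcal Y,\mathcal Z]=\mathcal V\text{-}\mathsf{cat}(\mathcal Y,\mathcal Z)$ of $\mathcal V$-functors with $[\mathcal Y,\mathcal Z](f,g)=\bigwedge_y\mathcal Z(fy,gy)$; it is enriched over itself. $\mathsf{Set}$ is regarded as a $\mathcal V\text{-}\mathsf{cat}$-category whose homs are the discrete $\mathcal V$-categories (distance $e$ between equal objects, $\bot$ otherwise) on the sets of functions; $D$ sends a set to the discrete $\mathcal V$-category on it. The enriched left Kan extension is $(\mathrm{Lan}_DH)\mathcal X\cong\mathcal V\text{-}\mathsf{cat}(D-,\mathcal X)*H$ (weighted colimit). $\mathbb N$ is the free $\mathcal V\text{-}\mathsf{cat}$-category on the ordinary category with objects all $r\in\mathcal V_o$ and an extra object $\mathsf o$, and non-identity arrows $\delta^r_0,\delta^r_1:r\to\mathsf o$. The weight $N:\mathbb N^{op}\to\mathcal V\text{-}\mathsf{cat}$ sends $\mathsf o$ to $\mathbb 1$ and $r$ to $\mathbb 2_r$, the $\mathcal V$-category with objects $0,1$, self-distances $e$, $\mathbb 2_r(0,1)=r$, $\mathbb 2_r(1,0)=\bot$; $N\delta^r_i$ picks $i$. $F_{\mathcal X}:\mathbb N\to\mathsf{Set}$ sends $\mathsf o$ to the set $X_{\mathsf o}$ of objects of $\mathcal X$, $r$ to $X_r=\{(x',x)\mid r\le\mathcal X(x',x)\}$, and $\delta^r_0,\delta^r_1$ to the first and second projections. The colimit of $(N,DF_{\mathcal X})$ is the weighted colimit $N*DF_{\mathcal X}$ in $\mathcal V\text{-}\mathsf{cat}$.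 *)

theory Defs
  imports Main "HOL-Library.FuncSet" "HOL-Library.Equipollence"
begin

section \<open>Commutative quantales\<close>

text \<open>The tensor is \<open>*\<close>, its unit \<open>e\<close> is \<open>1\<close>, and \<open>[r,s]\<close> is \<open>qhom r s\<close>.
  Monotonicity of \<open>*\<close> follows from the adjunction.\<close>

class commutative_quantale = complete_lattice + comm_monoid_mult +
  fixes qhom :: "'a \<Rightarrow> 'a \<Rightarrow> 'a"
  assumes qhom_adj: "x * r \<le> s \<longleftrightarrow> x \<le> qhom r s"

section \<open>Small sets\<close>

text \<open>The small sets are the members of a Grothendieck universe, rendered up to bijection: a family
  \<open>U\<close> of subsets of a type, closed under subsets, images, small unions and power sets.
  The map \<open>pr\<close> codes ordered pairs; together with the other axioms it gives closure
  under binary products and function sets.  As in SGA 4, the finite sets are not excluded.\<close>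

locale universe =
  fixes U :: "'u set set" and pr :: "'u \<times> 'u \<Rightarrow> 'u"
  assumes universe_nonempty: "\<exists>A\<in>U. A \<noteq> {}"
    and universe_subset: "\<And>A B. A \<in> U \<Longrightarrow> B \<subseteq> A \<Longrightarrow> B \<in> U"
    and universe_image: "\<And>A (f :: 'u \<Rightarrow> 'u). A \<in> U \<Longrightarrow> f ` A \<in> U"
    and universe_Union: "\<And>A B. A \<in> U \<Longrightarrow> (\<And>a. a \<in> A \<Longrightarrow> B a \<in> U) \<Longrightarrow> (\<Union>a\<in>A. B a) \<in> U"
    and universe_Pow: "\<And>A. A \<in> U \<Longrightarrow> \<exists>B\<in>U. Pow A \<lesssim> B"
    and inj_pr: "inj pr"

section \<open>\<open>\<V>\<close>-categories and \<open>\<V>\<close>-functors\<close>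

text \<open>\<open>vhom X x' x\<close> is \<open>\<X>(x',x)\<close>.  It is normalised to \<open>bot\<close> outside of the set of objects,
  so that a \<open>\<V>\<close>-category is determined by its objects and distances.\<close>

record ('a, 'v) vcat =
  vob :: "'a set"
  vhom :: "'a \<Rightarrow> 'a \<Rightarrow> 'v"

definition vcategory :: "('a, 'v::commutative_quantale) vcat \<Rightarrow> bool" where
  "vcategory X \<longleftrightarrow>
     (\<forall>x\<in>vob X. 1 \<le> vhom X x x) \<and>
     (\<forall>x\<in>vob X. \<forall>x'\<in>vob X. \<forall>x''\<in>vob X. vhom X x' x * vhom X x'' x' \<le> vhom X x'' x) \<and>
     (\<forall>x' x. x' \<notin> vob X \<or> x \<notin> vob X \<longrightarrow> vhom X x' x = bot)"

definition vfunctor :: "('a, 'v::commutative_quantale) vcat \<Rightarrow> ('b, 'v) vcat \<Rightarrow> ('a \<Rightarrow> 'b) \<Rightarrow> bool" where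
  "vfunctor X Y f \<longleftrightarrow>
     (\<forall>x\<in>vob X. f x \<in> vob Y) \<and>
     (\<forall>x'\<in>vob X. \<forall>x\<in>vob X. vhom X x' x \<le> vhom Y (f x') (f x))"

definition viso :: "('a, 'v::commutative_quantale) vcat \<Rightarrow> ('b, 'v) vcat \<Rightarrow> ('a \<Rightarrow> 'b) \<Rightarrow> bool" where
  "viso X Y f \<longleftrightarrow> vfunctor X Y f \<and>
     (\<exists>g. vfunctor Y X g \<and> (\<forall>x\<in>vob X. g (f x) = x) \<and> (\<forall>y\<in>vob Y. f (g y) = y))"

definition vtensor :: "('a, 'v::commutative_quantale) vcat \<Rightarrow> ('b, 'v) vcat \<Rightarrow> ('a \<times> 'b, 'v) vcat" where
  "vtensor X Y = \<lparr>vob = vob X \<times> vob Y,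
     vhom = (\<lambda>(x', y') (x, y).
       if x' \<in> vob X \<and> x \<in> vob X \<and> y' \<in> vob Y \<and> y \<in> vob Y
       then vhom X x' x * vhom Y y' y else bot)\<rparr>"

definition vdisc :: "'a set \<Rightarrow> ('a, 'v::commutative_quantale) vcat" where
  "vdisc S = \<lparr>vob = S, vhom = (\<lambda>x y. if x \<in> S \<and> x = y then 1 else bot)\<rparr>"

text \<open>The internal hom \<open>[Y,Z]\<close>; its objects are the \<open>\<V>\<close>-functors as extensional functions.\<close>

definition vfunctors :: "('a, 'v::commutative_quantale) vcat \<Rightarrow> ('b, 'v) vcat \<Rightarrow> ('a \<Rightarrow> 'b) set" where
  "vfunctors Y Z = {f \<in> extensional (vob Y). vfunctor Y Z f}"

definition vexp :: "('a, 'v::commutative_quantale) vcat \<Rightarrow> ('b, 'v) vcat \<Rightarrow> ('a \<Rightarrow> 'b, 'v) vcat" where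
  "vexp Y Z = \<lparr>vob = vfunctors Y Z,
     vhom = (\<lambda>f g. if f \<in> vfunctors Y Z \<and> g \<in> vfunctors Y Z
                   then (INF y\<in>vob Y. vhom Z (f y) (g y)) else bot)\<rparr>"

section \<open>Categories enriched in \<open>\<V>\<close>-cat\<close>

text \<open>\<open>Hm C a b\<close> is the \<open>\<V>\<close>-category of arrows from \<open>a\<close> to \<open>b\<close>, and \<open>Cmp C a b c g f\<close> is the
  composite of \<open>f : a \<rightarrow> b\<close> and \<open>g : b \<rightarrow> c\<close>.\<close>

record ('o, 'm, 'v) vvcat =
  Obj :: "'o set"
  Hm :: "'o \<Rightarrow> 'o \<Rightarrow> ('m, 'v) vcat"
  Cmp :: "'o \<Rightarrow> 'o \<Rightarrow> 'o \<Rightarrow> 'm \<Rightarrow> 'm \<Rightarrow> 'm"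
  Idn :: "'o \<Rightarrow> 'm"

definition vv_category :: "('o, 'm, 'v::commutative_quantale) vvcat \<Rightarrow> bool" where
  "vv_category C \<longleftrightarrow>
     (\<forall>a\<in>Obj C. \<forall>b\<in>Obj C. vcategory (Hm C a b)) \<and>
     (\<forall>a\<in>Obj C. Idn C a \<in> vob (Hm C a a)) \<and>
     (\<forall>a\<in>Obj C. \<forall>b\<in>Obj C. \<forall>c\<in>Obj C.
        vfunctor (vtensor (Hm C b c) (Hm C a b)) (Hm C a c) (\<lambda>(g, f). Cmp C a b c g f)) \<and>
     (\<forall>a\<in>Obj C. \<forall>b\<in>Obj C. \<forall>f\<in>vob (Hm C a b).
        Cmp C a a b f (Idn C a) = f \<and> Cmp C a b b (Idn C b) f = f) \<and>
     (\<forall>a\<in>Obj C. \<forall>b\<in>Obj C. \<forall>c\<in>Obj C. \<forall>d\<in>Obj C.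
        \<forall>f\<in>vob (Hm C a b). \<forall>g\<in>vob (Hm C b c). \<forall>h\<in>vob (Hm C c d).
        Cmp C a c d h (Cmp C a b c g f) = Cmp C a b d (Cmp C b c d h g) f)"

definition vv_op :: "('o, 'm, 'v) vvcat \<Rightarrow> ('o, 'm, 'v) vvcat" where
  "vv_op C = \<lparr>Obj = Obj C, Hm = (\<lambda>a b. Hm C b a), Cmp = (\<lambda>a b c g f. Cmp C c b a f g), Idn = Idn C\<rparr>"

record ('o, 'm, 'p, 'n) vvfun =
  Fo :: "'o \<Rightarrow> 'p"
  Fm :: "'o \<Rightarrow> 'o \<Rightarrow> 'm \<Rightarrow> 'n"

definition vv_functor :: "('o, 'm, 'v::commutative_quantale) vvcat \<Rightarrow> ('p, 'n, 'v) vvcat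
    \<Rightarrow> ('o, 'm, 'p, 'n) vvfun \<Rightarrow> bool" where
  "vv_functor A B F \<longleftrightarrow>
     (\<forall>a\<in>Obj A. Fo F a \<in> Obj B) \<and>
     (\<forall>a\<in>Obj A. \<forall>b\<in>Obj A. vfunctor (Hm A a b) (Hm B (Fo F a) (Fo F b)) (Fm F a b)) \<and>
     (\<forall>a\<in>Obj A. Fm F a a (Idn A a) = Idn B (Fo F a)) \<and>
     (\<forall>a\<in>Obj A. \<forall>b\<in>Obj A. \<forall>c\<in>Obj A. \<forall>f\<in>vob (Hm A a b). \<forall>g\<in>vob (Hm A b c).
        Fm F a c (Cmp A a b c g f) = Cmp B (Fo F a) (Fo F b) (Fo F c) (Fm F b c g) (Fm F a b f))"

definition vv_comp :: "('p, 'n, 'q, 'l) vvfun \<Rightarrow> ('o, 'm, 'p, 'n) vvfun \<Rightarrow> ('o, 'm, 'q, 'l) vvfun" where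
  "vv_comp G F = \<lparr>Fo = (\<lambda>a. Fo G (Fo F a)), Fm = (\<lambda>a b f. Fm G (Fo F a) (Fo F b) (Fm F a b f))\<rparr>"

text \<open>A \<open>\<V>\<close>-functor out of the unit \<open>\<one>\<close> is an object, and \<open>\<V>\<close>-functors are determined by their
  action on objects; hence \<open>\<V>\<close>-cat-naturality is an equation between objects of the homs.\<close>

definition vv_natural :: "('o, 'm, 'v::commutative_quantale) vvcat \<Rightarrow> ('p, 'n, 'v) vvcat
    \<Rightarrow> ('o, 'm, 'p, 'n) vvfun \<Rightarrow> ('o, 'm, 'p, 'n) vvfun \<Rightarrow> ('o \<Rightarrow> 'n) \<Rightarrow> bool" where
  "vv_natural A B F G \<alpha> \<longleftrightarrow>
     (\<forall>a\<in>Obj A. \<alpha> a \<in> vob (Hm B (Fo F a) (Fo G a))) \<and>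
     (\<forall>a\<in>Obj A. \<forall>b\<in>Obj A. \<forall>f\<in>vob (Hm A a b).
        Cmp B (Fo F a) (Fo F b) (Fo G b) (\<alpha> b) (Fm F a b f) =
        Cmp B (Fo F a) (Fo G a) (Fo G b) (Fm G a b f) (\<alpha> a))"

definition vv_isomorphic :: "('o, 'm, 'v::commutative_quantale) vvcat \<Rightarrow> ('p, 'n, 'v) vvcat
    \<Rightarrow> ('o, 'm, 'p, 'n) vvfun \<Rightarrow> ('o, 'm, 'p, 'n) vvfun \<Rightarrow> bool" where
  "vv_isomorphic A B F G \<longleftrightarrow>
     (\<exists>\<alpha> \<beta>. vv_natural A B F G \<alpha> \<and> vv_natural A B G F \<beta> \<and>
        (\<forall>a\<in>Obj A. Cmp B (Fo F a) (Fo G a) (Fo F a) (\<beta> a) (\<alpha> a) = Idn B (Fo F a) \<and>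
                   Cmp B (Fo G a) (Fo F a) (Fo G a) (\<alpha> a) (\<beta> a) = Idn B (Fo G a)))"

text \<open>\<open>\<V>\<close>-cat as a category enriched over itself, on the \<open>\<V>\<close>-categories whose set of objects
  belongs to \<open>U\<close>.  The homs live on the type of functions rather than on the type underlying
  the universe; all homs from a \<open>U\<close>-small to a \<open>U\<close>-small category are small.\<close>

definition VCAT :: "'a set set \<Rightarrow> (('a, 'v::commutative_quantale) vcat, 'a \<Rightarrow> 'a, 'v) vvcat" where
  "VCAT U = \<lparr>Obj = {X. vcategory X \<and> vob X \<in> U}, Hm = vexp,
     Cmp = (\<lambda>X Y Z g f. compose (vob X) g f), Idn = (\<lambda>X. restrict id (vob X))\<rparr>"

text \<open>An ordinary category (objects, hom-sets, composition, identities) seen as a \<open>\<V>\<close>-cat-category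
  with discrete homs; this is the free \<open>\<V>\<close>-cat-category on it.\<close>

definition free_vv :: "'o set \<Rightarrow> ('o \<Rightarrow> 'o \<Rightarrow> 'm set) \<Rightarrow> ('o \<Rightarrow> 'o \<Rightarrow> 'o \<Rightarrow> 'm \<Rightarrow> 'm \<Rightarrow> 'm)
    \<Rightarrow> ('o \<Rightarrow> 'm) \<Rightarrow> ('o, 'm, 'v::commutative_quantale) vvcat" where
  "free_vv S H c i = \<lparr>Obj = S, Hm = (\<lambda>a b. vdisc (H a b)), Cmp = c, Idn = i\<rparr>"

definition SET :: "'a set set \<Rightarrow> ('a set, 'a \<Rightarrow> 'a, 'v::commutative_quantale) vvcat" where
  "SET U = free_vv U (\<lambda>A B. A \<rightarrow>\<^sub>E B) (\<lambda>A B C g f. compose A g f) (\<lambda>A. restrict id A)"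

definition Dfun :: "('a set, 'a \<Rightarrow> 'a, ('a, 'v::commutative_quantale) vcat, 'a \<Rightarrow> 'a) vvfun" where
  "Dfun = \<lparr>Fo = vdisc, Fm = (\<lambda>A B f. f)\<rparr>"

section \<open>Weighted colimits and left Kan extensions\<close>

text \<open>A weight on \<open>K\<close> is a \<open>\<V>\<close>-cat-functor \<open>W : K\<^sup>o\<^sup>p \<rightarrow> \<V>-cat\<close>; its values may live on any type.
  \<open>psh_hom K W Z\<close> is the \<open>\<V>\<close>-category \<open>[K\<^sup>o\<^sup>p, \<V>-cat](W, Z)\<close> of \<open>\<V>\<close>-cat-natural transformations,
  with distances the meet over \<open>k\<close> of the distances in \<open>[W k, Z k]\<close>.  Here \<open>W\<close> and \<open>Z\<close> may have
  values on different types, which is why \<open>vv_natural\<close> is not used.\<close>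

definition weight :: "('k, 'm, 'v::commutative_quantale) vvcat \<Rightarrow>
    ('k, 'm, ('w, 'v) vcat, 'w \<Rightarrow> 'w) vvfun \<Rightarrow> bool" where
  "weight K W \<longleftrightarrow> vv_functor (vv_op K) (VCAT UNIV) W"

definition psh_nat :: "('k, 'm, 'v::commutative_quantale) vvcat
    \<Rightarrow> ('k, 'm, ('w, 'v) vcat, 'w \<Rightarrow> 'w) vvfun \<Rightarrow> ('k, 'm, ('z, 'v) vcat, 'z \<Rightarrow> 'z) vvfun
    \<Rightarrow> ('k \<Rightarrow> 'w \<Rightarrow> 'z) set" where
  "psh_nat K W Z = {\<alpha> \<in> extensional (Obj K).
     (\<forall>k\<in>Obj K. \<alpha> k \<in> vob (vexp (Fo W k) (Fo Z k))) \<and>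
     (\<forall>k\<in>Obj K. \<forall>l\<in>Obj K. \<forall>f\<in>vob (Hm K k l). \<forall>w\<in>vob (Fo W l).
        \<alpha> k (Fm W l k f w) = Fm Z l k f (\<alpha> l w))}"

definition psh_hom :: "('k, 'm, 'v::commutative_quantale) vvcat
    \<Rightarrow> ('k, 'm, ('w, 'v) vcat, 'w \<Rightarrow> 'w) vvfun \<Rightarrow> ('k, 'm, ('z, 'v) vcat, 'z \<Rightarrow> 'z) vvfun
    \<Rightarrow> ('k \<Rightarrow> 'w \<Rightarrow> 'z, 'v) vcat" where
  "psh_hom K W Z = \<lparr>vob = psh_nat K W Z,
     vhom = (\<lambda>\<alpha> \<beta>. if \<alpha> \<in> psh_nat K W Z \<and> \<beta> \<in> psh_nat K W Z
       then (INF k\<in>Obj K. vhom (vexp (Fo W k) (Fo Z k)) (\<alpha> k) (\<beta> k)) else bot)\<rparr>"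

text \<open>\<open>hom_psh A F Y\<close> is the presheaf \<open>A(F-, Y)\<close>.\<close>

definition hom_psh :: "('o, 'n, 'v::commutative_quantale) vvcat \<Rightarrow> ('k, 'm, 'o, 'n) vvfun \<Rightarrow> 'o
    \<Rightarrow> ('k, 'm, ('n, 'v) vcat, 'n \<Rightarrow> 'n) vvfun" where
  "hom_psh A F Y = \<lparr>Fo = (\<lambda>k. Hm A (Fo F k) Y),
     Fm = (\<lambda>l k f. \<lambda>g\<in>vob (Hm A (Fo F l) Y). Cmp A (Fo F k) (Fo F l) Y g (Fm F k l f))\<rparr>"

text \<open>\<open>(C, \<mu>)\<close> is the colimit \<open>W * F\<close> of \<open>F : K \<rightarrow> A\<close>: the unit \<open>\<mu> : W \<rightarrow> A(F-, C)\<close> induces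
  isomorphisms \<open>A(C, Y) \<cong> [K\<^sup>o\<^sup>p, \<V>-cat](W, A(F-, Y))\<close> of \<open>\<V>\<close>-categories, for all \<open>Y\<close>.\<close>

definition is_colimit :: "('k, 'm, 'v::commutative_quantale) vvcat \<Rightarrow> ('o, 'n, 'v) vvcat
    \<Rightarrow> ('k, 'm, ('w, 'v) vcat, 'w \<Rightarrow> 'w) vvfun \<Rightarrow> ('k, 'm, 'o, 'n) vvfun
    \<Rightarrow> 'o \<Rightarrow> ('k \<Rightarrow> 'w \<Rightarrow> 'n) \<Rightarrow> bool" where
  "is_colimit K A W F C \<mu> \<longleftrightarrow>
     C \<in> Obj A \<and> \<mu> \<in> vob (psh_hom K W (hom_psh A F C)) \<and>
     (\<forall>Y\<in>Obj A. viso (Hm A C Y) (psh_hom K W (hom_psh A F Y))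
        (\<lambda>g. \<lambda>k\<in>Obj K. \<lambda>w\<in>vob (Fo W k). Cmp A (Fo F k) C Y g (\<mu> k w)))"

definition preserves_colimit :: "('k, 'm, 'v::commutative_quantale) vvcat \<Rightarrow> ('o, 'n, 'v) vvcat
    \<Rightarrow> ('p, 'l, 'v) vvcat \<Rightarrow> ('k, 'm, ('w, 'v) vcat, 'w \<Rightarrow> 'w) vvfun \<Rightarrow> ('k, 'm, 'o, 'n) vvfun
    \<Rightarrow> ('o, 'n, 'p, 'l) vvfun \<Rightarrow> bool" where
  "preserves_colimit K A B W F G \<longleftrightarrow>
     (\<forall>C \<mu>. is_colimit K A W F C \<mu> \<longrightarrow>
        is_colimit K B W (vv_comp G F) (Fo G C)
          (\<lambda>k\<in>Obj K. \<lambda>w\<in>vob (Fo W k). Fm G (Fo F k) C (\<mu> k w)))"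

text \<open>\<open>\<eta> : H \<rightarrow> L J\<close> exhibits \<open>L : C \<rightarrow> B\<close> as the left Kan extension of \<open>H : A \<rightarrow> B\<close> along
  \<open>J : A \<rightarrow> C\<close>: every \<open>L c\<close> is the colimit \<open>C(J-, c) * H\<close>, with unit the composite
  \<open>C(J a, c) \<rightarrow> B(L J a, L c) \<rightarrow> B(H a, L c)\<close> of \<open>L\<close> and precomposition with \<open>\<eta> a\<close>.\<close>

definition is_left_Kan :: "('k, 'm, 'v::commutative_quantale) vvcat \<Rightarrow> ('o, 'n, 'v) vvcat
    \<Rightarrow> ('p, 'l, 'v) vvcat \<Rightarrow> ('k, 'm, 'o, 'n) vvfun \<Rightarrow> ('k, 'm, 'p, 'l) vvfun
    \<Rightarrow> ('o, 'n, 'p, 'l) vvfun \<Rightarrow> ('k \<Rightarrow> 'l) \<Rightarrow> bool" where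
  "is_left_Kan A C B J H L \<eta> \<longleftrightarrow>
     vv_functor C B L \<and> vv_natural A B H (vv_comp L J) \<eta> \<and>
     (\<forall>c\<in>Obj C. is_colimit A B (hom_psh C J c) H (Fo L c)
        (\<lambda>a\<in>Obj A. \<lambda>f\<in>vob (Hm C (Fo J a) c).
           Cmp B (Fo H a) (Fo L (Fo J a)) (Fo L c) (Fm L (Fo J a) c f) (\<eta> a)))"

section \<open>Presenting \<open>\<V>\<close>-categories by discrete ones\<close>

text \<open>The ordinary category underlying \<open>\<N>\<close>: \<open>NId\<close> stands for every identity arrow and
  \<open>Delta0\<close>, \<open>Delta1\<close> for \<open>\<delta>\<^sub>0\<close>, \<open>\<delta>\<^sub>1\<close> at every \<open>r\<close>.\<close>

datatype 'v nobj = NO | NR 'v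
datatype narr = NId | Delta0 | Delta1

fun narrs :: "'v nobj \<Rightarrow> 'v nobj \<Rightarrow> narr set" where
  "narrs (NR r) NO = {Delta0, Delta1}"
| "narrs a b = (if a = b then {NId} else {})"

definition ncomp :: "narr \<Rightarrow> narr \<Rightarrow> narr" where
  "ncomp g f = (if g = NId then f else g)"

definition NN :: "('v::commutative_quantale nobj, narr, 'v) vvcat" where
  "NN = free_vv UNIV narrs (\<lambda>a b c. ncomp) (\<lambda>a. NId)"

definition vtwo :: "'v::commutative_quantale \<Rightarrow> (nat, 'v) vcat" where
  "vtwo r = \<lparr>vob = {0, 1},
     vhom = (\<lambda>i j. if i \<in> {0, 1} \<and> j = i then 1 else if i = 0 \<and> j = 1 then r else bot)\<rparr>"

definition Nweight_ob :: "'v::commutative_quantale nobj \<Rightarrow> (nat, 'v) vcat" where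
  "Nweight_ob a = (case a of NO \<Rightarrow> vdisc {0} | NR r \<Rightarrow> vtwo r)"

definition Nweight :: "('v::commutative_quantale nobj, narr, (nat, 'v) vcat, nat \<Rightarrow> nat) vvfun" where
  "Nweight = \<lparr>Fo = Nweight_ob,
     Fm = (\<lambda>a b f. \<lambda>i\<in>vob (Nweight_ob a). case f of NId \<Rightarrow> i | Delta0 \<Rightarrow> 0 | Delta1 \<Rightarrow> 1)\<rparr>"

text \<open>The diagram \<open>F\<^sub>X\<close>, where \<open>X\<^sub>r\<close> consists of the codes \<open>pr (x', x)\<close> of the pairs \<open>(x', x)\<close>.\<close>

definition NF_ob :: "('u \<times> 'u \<Rightarrow> 'u) \<Rightarrow> ('u, 'v::commutative_quantale) vcat \<Rightarrow> 'v nobj \<Rightarrow> 'u set" where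
  "NF_ob pr X a = (case a of NO \<Rightarrow> vob X
     | NR r \<Rightarrow> pr ` {(x', x). x' \<in> vob X \<and> x \<in> vob X \<and> r \<le> vhom X x' x})"

definition NF :: "('u \<times> 'u \<Rightarrow> 'u) \<Rightarrow> ('u, 'v::commutative_quantale) vcat
    \<Rightarrow> ('v nobj, narr, 'u set, 'u \<Rightarrow> 'u) vvfun" where
  "NF pr X = \<lparr>Fo = NF_ob pr X,
     Fm = (\<lambda>a b f. \<lambda>p\<in>NF_ob pr X a.
       case f of NId \<Rightarrow> p | Delta0 \<Rightarrow> fst (inv pr p) | Delta1 \<Rightarrow> snd (inv pr p))\<rparr>"

section \<open>The data above are categories, functors and weights\<close>

lemma q_mono: "(a::'v::commutative_quantale) \<le> b \<Longrightarrow> a * c \<le> b * c"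
  by (meson order_trans qhom_adj order_refl)
lemma q_mono2: "(a::'v::commutative_quantale) \<le> b \<Longrightarrow> c \<le> d \<Longrightarrow> a * c \<le> b * d"
  by (metis q_mono mult.commute order_trans)
lemma q_bot: "(bot::'v::commutative_quantale) * r = bot"
  by (meson bot.extremum_unique bot_least qhom_adj)
lemma q_bot2: "r * (bot::'v::commutative_quantale) = bot"
  by (metis q_bot mult.commute)

lemma vcategory_vdisc: "vcategory (vdisc S :: ('a,'v::commutative_quantale) vcat)"
  by (auto simp: vcategory_def vdisc_def q_bot q_bot2)

lemma vcategory_vtensor:
  "vcategory X \<Longrightarrow> vcategory Y \<Longrightarrow> vcategory (vtensor X (Y :: ('b,'v::commutative_quantale) vcat))"
  unfolding vcategory_def vtensor_def
  apply (auto)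
  subgoal by (metis mult_1 q_mono2)
  subgoal for x y x' y' x'' y''
  proof -
    assume A: "\<forall>x\<in>vob X. \<forall>x'\<in>vob X. \<forall>x''\<in>vob X. vhom X x' x * vhom X x'' x' \<le> vhom X x'' x"
     "\<forall>x\<in>vob Y. \<forall>x'\<in>vob Y. \<forall>x''\<in>vob Y. vhom Y x' x * vhom Y x'' x' \<le> vhom Y x'' x"
    "x \<in> vob X" "y \<in> vob Y" "x' \<in> vob X" "y' \<in> vob Y" "x'' \<in> vob X" "y'' \<in> vob Y"
    have "(vhom X x' x * vhom X x'' x') * (vhom Y y' y * vhom Y y'' y') \<le> vhom X x'' x * vhom Y y'' y"
      by (intro q_mono2) (use A in blast)+
    then show ?thesis by (simp add: ac_simps)
  qed
  done

lemma vcategory_vexp: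
  assumes "vcategory Y" "vcategory (Z :: ('b,'v::commutative_quantale) vcat)"
  shows "vcategory (vexp Y Z)"
proof -
  have t: "(INF y\<in>vob Y. vhom Z (g y) (h y)) * (INF y\<in>vob Y. vhom Z (f y) (g y)) \<le> vhom Z (f y) (h y)"
    if "f \<in> vfunctors Y Z" "g \<in> vfunctors Y Z" "h \<in> vfunctors Y Z" "y \<in> vob Y" for f g h y
  proof -
    have "(INF y\<in>vob Y. vhom Z (g y) (h y)) * (INF y\<in>vob Y. vhom Z (f y) (g y))
      \<le> vhom Z (g y) (h y) * vhom Z (f y) (g y)"
      by (intro q_mono2 INF_lower that)
    also have "\<dots> \<le> vhom Z (f y) (h y)"
      using that assms(2) by (auto simp: vcategory_def vfunctors_def vfunctor_def)
    finally show ?thesis .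
  qed
  show ?thesis
    unfolding vcategory_def vexp_def
    using assms
    by (auto simp: intro!: INF_greatest t) (auto simp: vfunctors_def vfunctor_def vcategory_def)
qed

lemma compose_vfunctors: "f \<in> vfunctors X Y \<Longrightarrow> g \<in> vfunctors Y Z \<Longrightarrow> compose (vob X) g f \<in> vfunctors X Z"
  unfolding vfunctors_def vfunctor_def compose_def by auto (meson order_trans)
lemma id_vfunctors: "restrict id (vob X) \<in> vfunctors X X"
  unfolding vfunctors_def vfunctor_def by auto

lemma vv_VCAT: "vv_category (VCAT U :: (('a,'v::commutative_quantale) vcat, _, 'v) vvcat)"
proof -
  have c: "vfunctor (vtensor (vexp Y Z) (vexp X Y)) (vexp X Z) (\<lambda>(g, f). compose (vob X) g f)"
    if "vcategory X" "vcategory Y" "vcategory Z" for X Y Z :: "('a,'v) vcat"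
    unfolding vfunctor_def
  proof (intro conjI ballI; clarsimp simp: vtensor_def vexp_def compose_vfunctors; intro INF_greatest)
    fix g f g' f' x assume A: "g \<in> vfunctors Y Z" "f \<in> vfunctors X Y" "g' \<in> vfunctors Y Z" "f' \<in> vfunctors X Y" "x \<in> vob X"
    have "(INF y\<in>vob Y. vhom Z (g y) (g' y)) * (INF y\<in>vob X. vhom Y (f y) (f' y))
      \<le> vhom Z (g (f' x)) (g' (f' x)) * vhom Z (g (f x)) (g (f' x))"
      apply (rule q_mono2)
       apply (rule INF_lower) using A apply (auto simp: vfunctors_def vfunctor_def)[1]
      apply (rule INF_lower2[OF A(5)]) using A apply (auto simp: vfunctors_def vfunctor_def)[1]
      done
    also have "\<dots> \<le> vhom Z (g (f x)) (g' (f' x))"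
      using that A by (auto simp: vcategory_def vfunctors_def vfunctor_def)
    finally show "(INF y\<in>vob Y. vhom Z (g y) (g' y)) * (INF y\<in>vob X. vhom Y (f y) (f' y))
      \<le> vhom Z (compose (vob X) g f x) (compose (vob X) g' f' x)"
      using A by (simp add: compose_def)
  qed
  show ?thesis
  unfolding vv_category_def
    apply (auto simp: VCAT_def vcategory_vexp c)
       apply (auto simp: vexp_def id_vfunctors)
     apply (auto simp: vfunctors_def vfunctor_def compose_def extensional_def fun_eq_iff)
    done
qed

lemma vv_SET: "vv_category (SET U :: (_,_,'v::commutative_quantale) vvcat)"
  unfolding vv_category_def
  apply (auto simp: SET_def free_vv_def vcategory_vdisc)
     apply (auto simp: vdisc_def)
     apply (auto simp: vfunctor_def vtensor_def)
        apply (auto simp: compose_def extensional_def fun_eq_iff PiE_def q_bot q_bot2)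
  done

lemma narrs_iff: "f \<in> narrs a b \<longleftrightarrow> (a = b \<and> f = NId) \<or> (\<exists>r. a = NR r \<and> b = NO \<and> f \<noteq> NId)"
  by (cases a; cases b; cases f) auto

lemma vv_NN: "vv_category NN"
  unfolding vv_category_def
  apply (simp add: NN_def free_vv_def vcategory_vdisc)
  apply (auto simp: vdisc_def vfunctor_def vtensor_def ncomp_def
      narrs_iff q_bot q_bot2)
  done

lemma vf_disc: "vfunctors (vdisc S) (vdisc T :: (_,'v::commutative_quantale) vcat) = S \<rightarrow>\<^sub>E T"
  by (auto simp: vfunctors_def vfunctor_def vdisc_def PiE_def Pi_def extensional_def)
lemma vf_disc2: "vcategory X \<Longrightarrow> vfunctors (vdisc S) X = S \<rightarrow>\<^sub>E vob X"
  by (auto simp: vfunctors_def vfunctor_def vdisc_def PiE_def Pi_def extensional_def vcategory_def)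

lemma D_functor: "vv_functor (SET U) (VCAT U) (Dfun :: (_,_,('a,'v::commutative_quantale) vcat,_) vvfun)"
  unfolding vv_functor_def
  apply (auto simp: SET_def free_vv_def Dfun_def VCAT_def vcategory_vdisc)
    apply (simp add: vdisc_def)
   apply (auto simp: vfunctor_def vexp_def vf_disc)
     apply (auto simp: vdisc_def PiE_iff extensional_def intro!: INF_greatest)
  done

lemma vcategory_vtwo: "vcategory (vtwo r)"
  unfolding vcategory_def vtwo_def by (auto simp: q_bot q_bot2)

lemma Nweight_weight: "weight NN (Nweight :: ('v::commutative_quantale nobj,_,_,_) vvfun)"
proof -
  have a: "vcategory (Nweight_ob a)" for a :: "'v nobj"
    by (auto simp: Nweight_ob_def vcategory_vdisc vcategory_vtwo split: nobj.split)
  show ?thesis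
  unfolding weight_def vv_functor_def
    apply (auto simp: NN_def free_vv_def vv_op_def Nweight_def VCAT_def a)
    subgoal for a b
      apply (cases a; cases b)
      apply (auto simp: vfunctor_def vexp_def vdisc_def Nweight_ob_def vtwo_def vfunctors_def split: narr.splits if_splits intro!: INF_greatest)
      done
    subgoal for a b c f g
      apply (cases a; cases b; cases c)
             apply (auto simp: vdisc_def Nweight_ob_def vtwo_def ncomp_def compose_def fun_eq_iff split: narr.splits if_splits)
      done
    done
qed

lemma (in universe) NF_functor:
  assumes X: "X \<in> Obj (VCAT U :: (('u,'v::commutative_quantale) vcat,_,'v) vvcat)"
  shows "vv_functor NN (SET U) (NF pr X)"
proof -
  have XU: "vob X \<in> U" using X by (auto simp: VCAT_def)
  have P: "pr ` (vob X \<times> vob X) \<in> U"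
  proof -
    have "pr ` (vob X \<times> vob X) = (\<Union>a\<in>vob X. (\<lambda>b. pr (a,b)) ` vob X)" by auto
    also have "\<dots> \<in> U" by (intro universe_Union universe_image XU)
    finally show ?thesis .
  qed
  have o: "NF_ob pr X a \<in> U" for a
    by (cases a) (auto simp: NF_ob_def XU intro!: universe_subset[OF P])
  have i: "inv pr (pr x) = x" for x using inj_pr by simp
  show ?thesis
    unfolding vv_functor_def
    apply (auto simp: NN_def free_vv_def NF_def SET_def o)
    subgoal for a b
      apply (cases a; cases b)
      apply (auto simp: vfunctor_def vdisc_def NF_ob_def i split: narr.splits if_splits)
      done
    subgoal for a b c f g
      apply (cases a; cases b; cases c)
             apply (auto simp: vdisc_def NF_ob_def i ncomp_def compose_def fun_eq_iff split: narr.splits if_splits)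
      done
    done
qed

end

theory Submission
  imports Defs
begin

text \<open>A cocone of weight \<open>N\<close> under \<open>P : \<N> \<rightarrow> B\<close> with vertex \<open>Y\<close> amounts to an arrow
  \<open>\<phi> : P o \<rightarrow> Y\<close> with \<open>r \<le> B(P r, Y)(\<phi> \<cdot> P \<delta>\<^sub>0, \<phi> \<cdot> P \<delta>\<^sub>1)\<close> for all \<open>r\<close>.  For \<open>P = D F\<^sub>X\<close> these
  arrows are the \<open>\<V>\<close>-functors \<open>X \<rightarrow> Y\<close>, so the colimits of \<open>(N, D F\<^sub>X)\<close> are the isomorphic copies of
  \<open>X\<close>, and \<open>G\<close> preserves them iff every arrow \<open>\<phi> : G D X\<^sub>o \<rightarrow> Y\<close> satisfying the condition above extends
  uniquely and isometrically along \<open>G D X\<^sub>o \<rightarrow> G X\<close>.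

  If \<open>G\<close> preserves them, then \<open>G = Lan\<^sub>D (G D)\<close>: a natural family \<open>\<tau>\<^sub>S : [D S, X] \<rightarrow> [G D S, Y]\<close> is
  determined by its value at \<open>D X\<^sub>o \<rightarrow> X\<close>, because every \<open>D S \<rightarrow> X\<close> factors through that map,
  and this value satisfies the condition because each \<open>\<tau>\<^sub>S\<close> is a \<open>\<V>\<close>-functor.  Conversely, if
  \<open>G\<close> is the left Kan extension of \<open>H\<close> with unit \<open>\<eta>\<close>, then such a \<open>\<phi>\<close> yields the natural family
  \<open>f \<mapsto> \<phi> \<cdot> G D f \<cdot> \<eta>\<^sub>S\<close>, where \<open>f : S \<rightarrow> X\<^sub>o\<close>.  It is \<open>\<V>\<close>-functorial because two maps \<open>S \<rightarrow> X\<^sub>o\<close> at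
  distance \<open>r\<close> are the two components of a map \<open>S \<rightarrow> X\<^sub>r\<close>.\<close>

section \<open>Categories and functors enriched in \<open>\<V>\<close>-cat\<close>

text \<open>A V-functor does not decrease distances; since its inverse does not either, both
  preserve them exactly. This turns the universal property of a colimit into a bijection and an
  equation of distances.\<close>

lemma viso_iff:
  "viso X Y f \<longleftrightarrow> bij_betw f (vob X) (vob Y) \<and>
     (\<forall>x'\<in>vob X. \<forall>x\<in>vob X. vhom Y (f x') (f x) = vhom X x' x)"
proof
  assume "viso X Y f"
  then obtain g where f: "vfunctor X Y f" and g: "vfunctor Y X g"
    and gf: "\<forall>x\<in>vob X. g (f x) = x" and fg: "\<forall>y\<in>vob Y. f (g y) = y"
    by (auto simp: viso_def)
  have "bij_betw f (vob X) (vob Y)"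
    by (rule bij_betw_byWitness[of _ g]) (use f g gf fg in \<open>auto simp: vfunctor_def\<close>)
  moreover have "vhom Y (f x') (f x) = vhom X x' x" if "x' \<in> vob X" "x \<in> vob X" for x' x
  proof (rule antisym)
    show "vhom X x' x \<le> vhom Y (f x') (f x)" using f that by (auto simp: vfunctor_def)
    have "vhom Y (f x') (f x) \<le> vhom X (g (f x')) (g (f x))"
      using f g that by (auto simp: vfunctor_def)
    then show "vhom Y (f x') (f x) \<le> vhom X x' x" using gf that by simp
  qed
  ultimately show "bij_betw f (vob X) (vob Y) \<and>
     (\<forall>x'\<in>vob X. \<forall>x\<in>vob X. vhom Y (f x') (f x) = vhom X x' x)" by blast
next
  assume *: "bij_betw f (vob X) (vob Y) \<and>
     (\<forall>x'\<in>vob X. \<forall>x\<in>vob X. vhom Y (f x') (f x) = vhom X x' x)"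
  let ?g = "inv_into (vob X) f"
  have g: "?g y \<in> vob X" "f (?g y) = y" if "y \<in> vob Y" for y
    using * that by (auto simp: bij_betw_def inv_into_into f_inv_into_f)
  have "vfunctor Y X ?g"
    using g * unfolding vfunctor_def by (metis order_refl)
  moreover have "vfunctor X Y f" using * by (auto simp: vfunctor_def bij_betw_def)
  moreover have "\<forall>x\<in>vob X. ?g (f x) = x" using * by (auto simp: bij_betw_def)
  ultimately show "viso X Y f" using g unfolding viso_def by blast
qed

lemma viso_comp:
  assumes f: "viso X Y f" and g: "viso Y Z g" and h: "\<And>x. x \<in> vob X \<Longrightarrow> h x = g (f x)"
  shows "viso X Z h"
proof -
  have "bij_betw h (vob X) (vob Z) \<longleftrightarrow> bij_betw (g \<circ> f) (vob X) (vob Z)"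
    by (rule bij_betw_cong) (simp add: h)
  then have "bij_betw h (vob X) (vob Z)"
    using f g by (auto simp: viso_iff intro: bij_betw_trans)
  moreover have "f x \<in> vob Y" if "x \<in> vob X" for x
    using f that by (auto simp: viso_iff bij_betw_def)
  ultimately show ?thesis using f g by (simp add: viso_iff h)
qed

lemma vob_vexp [simp]: "vob (vexp Y Z) = vfunctors Y Z"
  by (simp add: vexp_def)

lemma vhom_vexp:
  "f \<in> vfunctors Y Z \<Longrightarrow> g \<in> vfunctors Y Z \<Longrightarrow>
     vhom (vexp Y Z) f g = (INF y\<in>vob Y. vhom Z (f y) (g y))"
  by (simp add: vexp_def)

text \<open>This is \<open>viso_iff\<close> applied to the comparison map, with the distance of two
  natural families written out as a meet over \<open>Obj K\<close>.\<close>

lemma is_colimit_iff: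
  "is_colimit K A W F C \<mu> \<longleftrightarrow>
     C \<in> Obj A \<and> \<mu> \<in> psh_nat K W (hom_psh A F C) \<and>
     (\<forall>Y\<in>Obj A.
        let \<Phi> = \<lambda>g. \<lambda>k\<in>Obj K. \<lambda>w\<in>vob (Fo W k). Cmp A (Fo F k) C Y g (\<mu> k w) in
        bij_betw \<Phi> (vob (Hm A C Y)) (psh_nat K W (hom_psh A F Y)) \<and>
        (\<forall>g\<in>vob (Hm A C Y). \<forall>g'\<in>vob (Hm A C Y).
           (INF k\<in>Obj K. vhom (vexp (Fo W k) (Hm A (Fo F k) Y)) (\<Phi> g k) (\<Phi> g' k)) =
           vhom (Hm A C Y) g g'))"
proof -
  have "viso (Hm A C Y) (psh_hom K W (hom_psh A F Y)) \<Phi> \<longleftrightarrow>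
        bij_betw \<Phi> (vob (Hm A C Y)) (psh_nat K W (hom_psh A F Y)) \<and>
        (\<forall>g\<in>vob (Hm A C Y). \<forall>g'\<in>vob (Hm A C Y).
           (INF k\<in>Obj K. vhom (vexp (Fo W k) (Hm A (Fo F k) Y)) (\<Phi> g k) (\<Phi> g' k)) =
           vhom (Hm A C Y) g g')" for \<Phi> Y
    unfolding viso_iff
  proof (intro conj_cong ball_cong refl)
    \<comment> \<open>Bijectivity places both images in \<open>psh_nat\<close>, where the distance
      in \<open>psh_hom\<close> is the meet and not the default \<open>bot\<close>.\<close>
    fix g g' assume "bij_betw \<Phi> (vob (Hm A C Y)) (psh_nat K W (hom_psh A F Y))"
      and "g \<in> vob (Hm A C Y)" "g' \<in> vob (Hm A C Y)"
    then have "\<Phi> g \<in> psh_nat K W (hom_psh A F Y)" "\<Phi> g' \<in> psh_nat K W (hom_psh A F Y)"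
      by (auto dest: bij_betwE)
    then show "(vhom (psh_hom K W (hom_psh A F Y)) (\<Phi> g) (\<Phi> g') = vhom (Hm A C Y) g g') =
        ((INF k\<in>Obj K. vhom (vexp (Fo W k) (Hm A (Fo F k) Y)) (\<Phi> g k) (\<Phi> g' k)) =
           vhom (Hm A C Y) g g')"
      by (simp add: psh_hom_def) (simp add: hom_psh_def)
  qed (simp add: psh_hom_def)
  then show ?thesis unfolding is_colimit_def by (simp add: psh_hom_def Let_def)
qed

section \<open>Composition, functors and the effect of both on distances\<close>

lemma Idn_in: "vv_category B \<Longrightarrow> a \<in> Obj B \<Longrightarrow> Idn B a \<in> vob (Hm B a a)"
  unfolding vv_category_def by blast

lemma
  assumes "vv_category B" "a \<in> Obj B" "b \<in> Obj B"
  shows vv_vcategory: "vcategory (Hm B a b)"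
    and Cmp_Idn_right: "f \<in> vob (Hm B a b) \<Longrightarrow> Cmp B a a b f (Idn B a) = f"
    and Cmp_Idn_left: "f \<in> vob (Hm B a b) \<Longrightarrow> Cmp B a b b (Idn B b) f = f"
  using assms unfolding vv_category_def by blast+

lemma
  assumes "vv_category B" "a \<in> Obj B" "b \<in> Obj B" "c \<in> Obj B"
  shows vv_Cmp_vfunctor:
      "vfunctor (vtensor (Hm B b c) (Hm B a b)) (Hm B a c) (\<lambda>(g, f). Cmp B a b c g f)"
    and Cmp_in: "f \<in> vob (Hm B a b) \<Longrightarrow> g \<in> vob (Hm B b c) \<Longrightarrow> Cmp B a b c g f \<in> vob (Hm B a c)"
proof -
  show *: "vfunctor (vtensor (Hm B b c) (Hm B a b)) (Hm B a c) (\<lambda>(g, f). Cmp B a b c g f)"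
    using assms unfolding vv_category_def by blast
  show "Cmp B a b c g f \<in> vob (Hm B a c)" if "f \<in> vob (Hm B a b)" "g \<in> vob (Hm B b c)"
    using * that by (auto simp: vfunctor_def vtensor_def)
qed

lemma Cmp_assoc:
  assumes "vv_category B" "a \<in> Obj B" "b \<in> Obj B" "c \<in> Obj B" "d \<in> Obj B"
    and "f \<in> vob (Hm B a b)" "g \<in> vob (Hm B b c)" "h \<in> vob (Hm B c d)"
  shows "Cmp B a c d h (Cmp B a b c g f) = Cmp B a b d (Cmp B b c d h g) f"
  using assms unfolding vv_category_def by blast

text \<open>Composition is a V-functor on the tensor product of the homs. Keeping one factor fixed
  costs nothing, because its self-distance is at least the unit \<open>1\<close>.\<close>

lemma
  assumes B: "vv_category B" "a \<in> Obj B" "b \<in> Obj B" "c \<in> Obj B"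
  shows vhom_precomp: "f \<in> vob (Hm B a b) \<Longrightarrow> g \<in> vob (Hm B b c) \<Longrightarrow> g' \<in> vob (Hm B b c) \<Longrightarrow>
      vhom (Hm B b c) g g' \<le> vhom (Hm B a c) (Cmp B a b c g f) (Cmp B a b c g' f)"
    and vhom_postcomp: "f \<in> vob (Hm B a b) \<Longrightarrow> f' \<in> vob (Hm B a b) \<Longrightarrow> g \<in> vob (Hm B b c) \<Longrightarrow>
      vhom (Hm B a b) f f' \<le> vhom (Hm B a c) (Cmp B a b c g f) (Cmp B a b c g f')"
proof -
  have c: "vhom (Hm B b c) g g' * vhom (Hm B a b) f f'
      \<le> vhom (Hm B a c) (Cmp B a b c g f) (Cmp B a b c g' f')"
    if "f \<in> vob (Hm B a b)" "f' \<in> vob (Hm B a b)" "g \<in> vob (Hm B b c)" "g' \<in> vob (Hm B b c)"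
    for f f' g g'
    using vv_Cmp_vfunctor[OF B] that by (auto simp: vfunctor_def vtensor_def)
  have one: "1 \<le> vhom (Hm B x y) f f"
    if "x \<in> Obj B" "y \<in> Obj B" "f \<in> vob (Hm B x y)" for x y f
    using vv_vcategory[OF B(1) that(1,2)] that by (auto simp: vcategory_def)
  show "vhom (Hm B b c) g g' \<le> vhom (Hm B a c) (Cmp B a b c g f) (Cmp B a b c g' f)"
    if "f \<in> vob (Hm B a b)" "g \<in> vob (Hm B b c)" "g' \<in> vob (Hm B b c)"
    using order_trans[OF q_mono2[OF order_refl one[OF B(2,3) that(1)]] c[OF that(1,1,2,3)]] by simp
  show "vhom (Hm B a b) f f' \<le> vhom (Hm B a c) (Cmp B a b c g f) (Cmp B a b c g f')"
    if "f \<in> vob (Hm B a b)" "f' \<in> vob (Hm B a b)" "g \<in> vob (Hm B b c)"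
    using order_trans[OF q_mono2[OF one[OF B(3,4) that(3)] order_refl] c[OF that(1,2,3,3)]] by simp
qed

lemma
  assumes "vv_functor A B F" "a \<in> Obj A"
  shows Fo_in: "Fo F a \<in> Obj B"
    and Fm_Idn: "Fm F a a (Idn A a) = Idn B (Fo F a)"
  using assms unfolding vv_functor_def by blast+

lemma
  assumes "vv_functor A B F" "a \<in> Obj A" "b \<in> Obj A" "f \<in> vob (Hm A a b)"
  shows Fm_in: "Fm F a b f \<in> vob (Hm B (Fo F a) (Fo F b))"
    and Fm_le: "f' \<in> vob (Hm A a b) \<Longrightarrow>
      vhom (Hm A a b) f f' \<le> vhom (Hm B (Fo F a) (Fo F b)) (Fm F a b f) (Fm F a b f')"
    and Fm_Cmp: "c \<in> Obj A \<Longrightarrow> g \<in> vob (Hm A b c) \<Longrightarrow>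
      Fm F a c (Cmp A a b c g f) = Cmp B (Fo F a) (Fo F b) (Fo F c) (Fm F b c g) (Fm F a b f)"
  using assms unfolding vv_functor_def vfunctor_def by blast+

lemma vv_functor_comp:
  assumes F: "vv_functor A B F" and G: "vv_functor B C G"
  shows "vv_functor A C (vv_comp G F)"
  unfolding vv_functor_def vfunctor_def vv_comp_def
  using Fo_in[OF F] Fo_in[OF G] Fm_Idn[OF F] Fm_Idn[OF G] Fm_in[OF F] Fm_in[OF G]
    Fm_Cmp[OF F] Fm_Cmp[OF G]
  by (auto intro: order_trans[OF Fm_le[OF F] Fm_le[OF G]])

lemma vv_comp_simps [simp]:
  "Fo (vv_comp G F) a = Fo G (Fo F a)"
  "Fm (vv_comp G F) a b f = Fm G (Fo F a) (Fo F b) (Fm F a b f)"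
  by (simp_all add: vv_comp_def)

lemma vv_isomorphic_refl:
  assumes B: "vv_category B" and F: "vv_functor A B F"
  shows "vv_isomorphic A B F F"
proof -
  have "vv_natural A B F F (\<lambda>a. Idn B (Fo F a))"
    unfolding vv_natural_def using Idn_in[OF B] Fo_in[OF F] Fm_in[OF F]
      Cmp_Idn_left[OF B] Cmp_Idn_right[OF B] by auto
  moreover have "\<forall>a\<in>Obj A. Cmp B (Fo F a) (Fo F a) (Fo F a) (Idn B (Fo F a)) (Idn B (Fo F a))
      = Idn B (Fo F a)"
    using Cmp_Idn_left[OF B Fo_in[OF F] Fo_in[OF F] Idn_in[OF B Fo_in[OF F]]] by blast
  ultimately show ?thesis unfolding vv_isomorphic_def by blast
qed

section \<open>Colimits weighted by \<open>N\<close>\<close>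

lemma NN_simps [simp]: "Obj NN = UNIV" "vob (Hm NN a b) = narrs a b" "Idn NN a = NId"
    "Cmp NN a b c g f = ncomp g f"
  by (simp_all add: NN_def free_vv_def vdisc_def)

declare narrs.simps [simp del]

lemma narrs_simps [simp]:
  "f \<in> narrs (NR r) NO \<longleftrightarrow> f \<noteq> NId" "f \<in> narrs k k \<longleftrightarrow> f = NId"
  by (auto simp: narrs_iff)

lemma Nweight_ob_simps [simp]: "vob (Nweight_ob NO) = {0}" "vob (Nweight_ob (NR r)) = {0, 1}"
  by (simp_all add: Nweight_ob_def vdisc_def vtwo_def)

section \<open>Cocones of weight N encoded by a single arrow\<close>

text \<open>The inequality at \<open>r\<close> is V-functoriality of the component at
  \<open>NR r\<close>: the only distances in \<open>vtwo r\<close> are \<open>r\<close> from 0 to 1,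
  the unit on the diagonal, and \<open>bot\<close>.\<close>

definition ncompat where
  "ncompat B P Y \<phi> \<longleftrightarrow> \<phi> \<in> vob (Hm B (Fo P NO) Y) \<and>
     (\<forall>r. r \<le> vhom (Hm B (Fo P (NR r)) Y)
        (Cmp B (Fo P (NR r)) (Fo P NO) Y \<phi> (Fm P (NR r) NO Delta0))
        (Cmp B (Fo P (NR r)) (Fo P NO) Y \<phi> (Fm P (NR r) NO Delta1)))"

text \<open>Naturality at the two arrows \<open>r -> o\<close> forces these values at 0 and 1, so
  nothing but the component at \<open>NO\<close> can be chosen.\<close>

definition ncocone where
  "ncocone B P Y \<phi> = (\<lambda>k. \<lambda>i\<in>vob (Nweight_ob k). case k of NO \<Rightarrow> \<phi>
     | NR r \<Rightarrow> Cmp B (Fo P k) (Fo P NO) Y \<phi> (Fm P k NO (if i = (0::nat) then Delta0 else Delta1)))"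

text \<open>The universal property of the N-weighted colimit, read off at \<open>NO\<close> alone;
  \<open>is_colimit_NN\<close> justifies this form.\<close>

definition ncolim where
  "ncolim B P C m \<longleftrightarrow> C \<in> Obj B \<and> ncompat B P C m \<and>
     (\<forall>Y\<in>Obj B. bij_betw (\<lambda>g. Cmp B (Fo P NO) C Y g m) (vob (Hm B C Y)) (Collect (ncompat B P Y)) \<and>
       (\<forall>g\<in>vob (Hm B C Y). \<forall>g'\<in>vob (Hm B C Y).
          vhom (Hm B (Fo P NO) Y) (Cmp B (Fo P NO) C Y g m) (Cmp B (Fo P NO) C Y g' m)
            = vhom (Hm B C Y) g g'))"

lemma ncocone_NO [simp]: "ncocone B P Y \<phi> NO 0 = \<phi>"
  by (simp add: ncocone_def)

text \<open>Associativity moves \<open>g\<close> past the arrows \<open>Delta0\<close> and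
  \<open>Delta1\<close>, and postcomposition with \<open>g\<close> does not decrease the distance
  between the two composites.\<close>

lemma ncompat_Cmp:
  assumes B: "vv_category B" and P: "vv_functor NN B P" and C: "C \<in> Obj B" and Y: "Y \<in> Obj B"
    and m: "ncompat B P C m" and g: "g \<in> vob (Hm B C Y)"
  shows "ncompat B P Y (Cmp B (Fo P NO) C Y g m)" (is "ncompat B P Y (?c g)")
  unfolding ncompat_def
proof (intro conjI allI)
  have m': "m \<in> vob (Hm B (Fo P NO) C)" using m by (simp add: ncompat_def)
  show "?c g \<in> vob (Hm B (Fo P NO) Y)"
    by (intro Cmp_in[OF B] Fo_in[OF P] C Y g m') simp
  fix r
  have D: "Fm P (NR r) NO x \<in> vob (Hm B (Fo P (NR r)) (Fo P NO))" if "x \<noteq> NId" for x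
    by (intro Fm_in[OF P]) (use that in \<open>auto simp: narrs_iff\<close>)
  let ?m = "\<lambda>x. Cmp B (Fo P (NR r)) (Fo P NO) C m (Fm P (NR r) NO x)"
  have mx: "?m x \<in> vob (Hm B (Fo P (NR r)) C)" if "x \<noteq> NId" for x
    by (intro Cmp_in[OF B] Fo_in[OF P] C m' D that) simp_all
  have e: "Cmp B (Fo P (NR r)) (Fo P NO) Y (?c g) (Fm P (NR r) NO x)
      = Cmp B (Fo P (NR r)) C Y g (?m x)" if "x \<noteq> NId" for x
    by (rule sym, intro Cmp_assoc[OF B] Fo_in[OF P] D Y C g m' that) simp_all
  have "r \<le> vhom (Hm B (Fo P (NR r)) C) (?m Delta0) (?m Delta1)"
    using m by (simp add: ncompat_def)
  also have "\<dots> \<le> vhom (Hm B (Fo P (NR r)) Y) (Cmp B (Fo P (NR r)) C Y g (?m Delta0))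
      (Cmp B (Fo P (NR r)) C Y g (?m Delta1))"
    by (intro vhom_postcomp[OF B] Fo_in[OF P] Y C g mx) simp_all
  finally show "r \<le> vhom (Hm B (Fo P (NR r)) Y)
     (Cmp B (Fo P (NR r)) (Fo P NO) Y (?c g) (Fm P (NR r) NO Delta0))
     (Cmp B (Fo P (NR r)) (Fo P NO) Y (?c g) (Fm P (NR r) NO Delta1))" by (simp add: e)
qed

text \<open>\<open>G\<close> commutes with the two composites by functoriality and does not decrease
  distances on homs.\<close>

lemma ncompat_Fm:
  assumes P: "vv_functor NN A P" and G: "vv_functor A B G" and C: "C \<in> Obj A"
    and A: "vv_category A" and m: "ncompat A P C m"
  shows "ncompat B (vv_comp G P) (Fo G C) (Fm G (Fo P NO) C m)"
proof -
  have m': "m \<in> vob (Hm A (Fo P NO) C)" using m by (simp add: ncompat_def)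
  have D: "Fm P (NR r) NO x \<in> vob (Hm A (Fo P (NR r)) (Fo P NO))" if "x \<noteq> NId" for r x
    using Fm_in[OF P, of "NR r" NO x] that by simp
  have in_A: "Cmp A (Fo P (NR r)) (Fo P NO) C m (Fm P (NR r) NO x) \<in> vob (Hm A (Fo P (NR r)) C)"
    if "x \<noteq> NId" for r x
    by (intro Cmp_in[OF A] Fo_in[OF P] C m' D that) simp_all
  have e: "Cmp B (Fo G (Fo P (NR r))) (Fo G (Fo P NO)) (Fo G C) (Fm G (Fo P NO) C m)
      (Fm G (Fo P (NR r)) (Fo P NO) (Fm P (NR r) NO x)) =
      Fm G (Fo P (NR r)) C (Cmp A (Fo P (NR r)) (Fo P NO) C m (Fm P (NR r) NO x))"
    if "x \<noteq> NId" for r x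
    by (rule sym, intro Fm_Cmp[OF G] Fo_in[OF P] D C m' that) simp_all
  have "r \<le> vhom (Hm B (Fo G (Fo P (NR r))) (Fo G C))
      (Fm G (Fo P (NR r)) C (Cmp A (Fo P (NR r)) (Fo P NO) C m (Fm P (NR r) NO Delta0)))
      (Fm G (Fo P (NR r)) C (Cmp A (Fo P (NR r)) (Fo P NO) C m (Fm P (NR r) NO Delta1)))" for r
    by (rule order_trans[OF _ Fm_le[OF G Fo_in[OF P] C in_A in_A]])
      (use m in \<open>auto simp: ncompat_def\<close>)
  then show ?thesis
    using Fm_in[OF G Fo_in[OF P] C m'] by (simp add: ncompat_def e)
qed

text \<open>A natural family is recovered from its value at the one object of the weight at
  \<open>NO\<close>. Conversely, naturality has to be checked only on identities and on the arrows
  \<open>r -> o\<close>, the latter holding by construction of \<open>ncocone\<close>.\<close>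

lemma psh_nat_NN:
  assumes B: "vv_category B" and P: "vv_functor NN B P" and Y: "Y \<in> Obj B"
  shows "psh_nat NN Nweight (hom_psh B P Y) = ncocone B P Y ` Collect (ncompat B P Y)"
proof (intro equalityI subsetI)
  fix \<alpha> assume "\<alpha> \<in> psh_nat NN Nweight (hom_psh B P Y)"
  then have v: "\<alpha> k \<in> vfunctors (Nweight_ob k) (Hm B (Fo P k) Y)"
    and n: "\<And>f i. f \<in> narrs k l \<Longrightarrow> i \<in> vob (Nweight_ob l) \<Longrightarrow> \<alpha> k (Fm Nweight l k f i)
        = Fm (hom_psh B P Y) l k f (\<alpha> l i)" for k l
    by (auto simp: psh_nat_def Nweight_def hom_psh_def)
  have \<phi>: "\<alpha> NO 0 \<in> vob (Hm B (Fo P NO) Y)"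
    using v[of NO] by (auto simp: vfunctors_def vfunctor_def)
  have d: "\<alpha> (NR r) 0 = Cmp B (Fo P (NR r)) (Fo P NO) Y (\<alpha> NO 0) (Fm P (NR r) NO Delta0)"
    "\<alpha> (NR r) (Suc 0) = Cmp B (Fo P (NR r)) (Fo P NO) Y (\<alpha> NO 0) (Fm P (NR r) NO Delta1)" for r
    using n[of Delta0 "NR r" NO 0] n[of Delta1 "NR r" NO 0] \<phi>
    by (simp_all add: Nweight_def hom_psh_def)
  have "r \<le> vhom (Hm B (Fo P (NR r)) Y) (\<alpha> (NR r) 0) (\<alpha> (NR r) (Suc 0))" for r
    using v[of "NR r"] by (auto simp: vfunctors_def vfunctor_def Nweight_ob_def vtwo_def)
  then have "ncompat B P Y (\<alpha> NO 0)" using \<phi> by (simp add: ncompat_def d)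
  moreover have "\<alpha> k i = ncocone B P Y (\<alpha> NO 0) k i" for k i
    using v[of k] by (cases k) (auto simp: ncocone_def d vfunctors_def extensional_def)
  ultimately show "\<alpha> \<in> ncocone B P Y ` Collect (ncompat B P Y)" by (metis ext image_eqI mem_Collect_eq)
next
  fix \<alpha> assume "\<alpha> \<in> ncocone B P Y ` Collect (ncompat B P Y)"
  then obtain \<phi> where \<phi>: "ncompat B P Y \<phi>" and \<alpha>: "\<alpha> = ncocone B P Y \<phi>" by blast
  have p: "\<phi> \<in> vob (Hm B (Fo P NO) Y)" using \<phi> by (simp add: ncompat_def)
  have m: "Fm P (NR r) NO x \<in> vob (Hm B (Fo P (NR r)) (Fo P NO))" if "x \<noteq> NId" for r x
    using Fm_in[OF P, of "NR r" NO x] that by simp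
  have c: "Cmp B (Fo P (NR r)) (Fo P NO) Y \<phi> (Fm P (NR r) NO x) \<in> vob (Hm B (Fo P (NR r)) Y)"
    if "x \<noteq> NId" for r x
    by (intro Cmp_in[OF B] Fo_in[OF P] p Y m that) simp_all
  have one: "1 \<le> vhom (Hm B (Fo P k) Y) f f" if "f \<in> vob (Hm B (Fo P k) Y)" for k f
    using vv_vcategory[OF B Fo_in[OF P, of k] Y] that by (auto simp: vcategory_def)
  have v: "\<alpha> k \<in> vfunctors (Nweight_ob k) (Hm B (Fo P k) Y)" for k
  proof (cases k)
    case NO
    then show ?thesis using p one[OF p]
      by (auto simp: \<alpha> ncocone_def vfunctors_def vfunctor_def Nweight_ob_def vdisc_def)
  next
    case (NR r)
    then show ?thesis using c one[OF c] \<phi>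
      by (auto simp: \<alpha> ncocone_def vfunctors_def vfunctor_def Nweight_ob_def vtwo_def ncompat_def)
  qed
  have id: "Cmp B (Fo P k) (Fo P k) Y f (Fm P k k NId) = f" if "f \<in> vob (Hm B (Fo P k) Y)" for k f
    using Fm_Idn[OF P, of k] Cmp_Idn_right[OF B Fo_in[OF P, of k] Y that] by simp
  have i: "\<alpha> k i \<in> vob (Hm B (Fo P k) Y)" if "i \<in> vob (Nweight_ob k)" for k i
    using v[of k] that by (auto simp: vfunctors_def vfunctor_def)
  have n: "\<alpha> k (Fm Nweight l k f w) = Fm (hom_psh B P Y) l k f (\<alpha> l w)"
    if "f \<in> narrs k l" "w \<in> vob (Nweight_ob l)" for k l f w
  proof (cases "k = l")
    case True
    then show ?thesis using that id[OF i] i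
      by (auto simp: Nweight_def hom_psh_def)
  next
    case False
    then obtain r where "k = NR r" "l = NO" "f \<noteq> NId" using \<open>f \<in> narrs k l\<close> by (auto simp: narrs_iff)
    then show ?thesis using that p
      by (cases f) (auto simp: Nweight_def hom_psh_def \<alpha> ncocone_def)
  qed
  show "\<alpha> \<in> psh_nat NN Nweight (hom_psh B P Y)"
    using v n by (simp add: psh_nat_def) (simp add: Nweight_def hom_psh_def)
qed

text \<open>The meet is attained at \<open>NO\<close>: the components at \<open>NR r\<close> arise
  by precomposition, which does not decrease distances, so their terms are at least as
  large.\<close>

lemma vhom_ncocone:
  assumes B: "vv_category B" and P: "vv_functor NN B P" and Y: "Y \<in> Obj B"
    and \<phi>: "ncompat B P Y \<phi>" and \<psi>: "ncompat B P Y \<psi>"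
  shows "(INF k. vhom (vexp (Nweight_ob k) (Hm B (Fo P k) Y)) (ncocone B P Y \<phi> k) (ncocone B P Y \<psi> k))
     = vhom (Hm B (Fo P NO) Y) \<phi> \<psi>" (is "(INF k. ?d k) = _")
proof (rule antisym)
  have "ncocone B P Y \<chi> k \<in> vfunctors (Nweight_ob k) (Hm B (Fo P k) Y)" if "ncompat B P Y \<chi>" for \<chi> k
  proof -
    have "ncocone B P Y \<chi> \<in> psh_nat NN Nweight (hom_psh B P Y)"
      unfolding psh_nat_NN[OF B P Y] using that by blast
    then show ?thesis by (auto simp: psh_nat_def Nweight_def hom_psh_def)
  qed
  then have d: "?d k = (INF i\<in>vob (Nweight_ob k).
      vhom (Hm B (Fo P k) Y) (ncocone B P Y \<phi> k i) (ncocone B P Y \<psi> k i))" for k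
    using \<phi> \<psi> by (simp add: vhom_vexp)
  have "?d NO = vhom (Hm B (Fo P NO) Y) \<phi> \<psi>" by (simp add: d)
  moreover have "(INF k. ?d k) \<le> ?d NO" by (rule INF_lower) simp
  ultimately show "(INF k. ?d k) \<le> vhom (Hm B (Fo P NO) Y) \<phi> \<psi>" by simp
  have m: "Fm P (NR r) NO x \<in> vob (Hm B (Fo P (NR r)) (Fo P NO))" if "x \<noteq> NId" for r x
    using Fm_in[OF P, of "NR r" NO x] that by simp
  have le: "vhom (Hm B (Fo P NO) Y) \<phi> \<psi> \<le> vhom (Hm B (Fo P (NR r)) Y)
      (Cmp B (Fo P (NR r)) (Fo P NO) Y \<phi> (Fm P (NR r) NO x))
      (Cmp B (Fo P (NR r)) (Fo P NO) Y \<psi> (Fm P (NR r) NO x))" if "x \<noteq> NId" for r x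
    by (intro vhom_precomp[OF B] Fo_in[OF P] Y m that) (use \<phi> \<psi> in \<open>auto simp: ncompat_def\<close>)
  have "vhom (Hm B (Fo P NO) Y) \<phi> \<psi> \<le> ?d k" for k
    unfolding d by (cases k) (auto simp: ncocone_def le)
  then show "vhom (Hm B (Fo P NO) Y) \<phi> \<psi> \<le> (INF k. ?d k)" by (simp add: INF_greatest)
qed

text \<open>The comparison map of the colimit is composition with \<open>m\<close> followed by
  \<open>ncocone\<close>. The latter is a bijection from compatible arrows to cocones and preserves
  distances, so it can be cancelled.\<close>

lemma is_colimit_NN:
  assumes B: "vv_category B" and P: "vv_functor NN B P"
  shows "is_colimit NN B Nweight P C \<mu> \<longleftrightarrow> (\<exists>m. \<mu> = ncocone B P C m \<and> ncolim B P C m)"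
proof -
  have "(bij_betw \<Phi> (vob (Hm B C Y)) (psh_nat NN Nweight (hom_psh B P Y)) \<and>
        (\<forall>g\<in>vob (Hm B C Y). \<forall>g'\<in>vob (Hm B C Y).
           (INF k\<in>Obj NN. vhom (vexp (Nweight_ob k) (Hm B (Fo P k) Y)) (\<Phi> g k) (\<Phi> g' k)) =
           vhom (Hm B C Y) g g')) \<longleftrightarrow>
     (bij_betw (\<lambda>g. Cmp B (Fo P NO) C Y g m) (vob (Hm B C Y)) (Collect (ncompat B P Y)) \<and>
       (\<forall>g\<in>vob (Hm B C Y). \<forall>g'\<in>vob (Hm B C Y).
          vhom (Hm B (Fo P NO) Y) (Cmp B (Fo P NO) C Y g m) (Cmp B (Fo P NO) C Y g' m)
            = vhom (Hm B C Y) g g'))"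
    if Y: "Y \<in> Obj B" and C: "C \<in> Obj B" and m: "ncompat B P C m"
      and \<Phi>_def: "\<Phi> = (\<lambda>g. \<lambda>k\<in>Obj NN. \<lambda>w\<in>vob (Nweight_ob k). Cmp B (Fo P k) C Y g (ncocone B P C m k w))"
    for Y m \<Phi>
  proof -
    let ?c = "\<lambda>g. Cmp B (Fo P NO) C Y g m"
    have \<Phi>: "\<Phi> g = ncocone B P Y (?c g)" if "g \<in> vob (Hm B C Y)" for g
    proof (intro ext)
      fix k i
      have "Cmp B (Fo P (NR r)) C Y g (Cmp B (Fo P (NR r)) (Fo P NO) C m (Fm P (NR r) NO x)) =
        Cmp B (Fo P (NR r)) (Fo P NO) Y (Cmp B (Fo P NO) C Y g m) (Fm P (NR r) NO x)" if "x \<noteq> NId" for r x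
        by (intro Cmp_assoc[OF B] Fo_in[OF P] Fm_in[OF P] Y C \<open>g \<in> _\<close>)
          (use m that in \<open>auto simp: ncompat_def\<close>)
      then show "\<Phi> g k i = ncocone B P Y (?c g) k i"
        unfolding \<Phi>_def by (cases k) (auto simp: ncocone_def restrict_def)
    qed
    have cin: "ncompat B P Y (?c g)" if "g \<in> vob (Hm B C Y)" for g
      by (rule ncompat_Cmp[OF B P C Y m that])
    have inj: "inj_on (ncocone B P Y) S" for S
      by (rule inj_onI) (metis ncocone_NO)
    \<comment> \<open>On the arrows \<open>C -> Y\<close> the comparison map is
      \<open>ncocone B P Y\<close> after \<open>?c\<close>; the injective factor is then
      removed.\<close>
    have "bij_betw \<Phi> (vob (Hm B C Y)) (psh_nat NN Nweight (hom_psh B P Y)) \<longleftrightarrow>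
        bij_betw (ncocone B P Y \<circ> ?c) (vob (Hm B C Y)) (ncocone B P Y ` Collect (ncompat B P Y))"
      unfolding psh_nat_NN[OF B P Y] by (intro bij_betw_cong) (simp add: \<Phi>)
    also have "\<dots> \<longleftrightarrow> bij_betw ?c (vob (Hm B C Y)) (Collect (ncompat B P Y))"
      by (subst bij_betw_comp_iff2[where f' = "ncocone B P Y" and A'' = "ncocone B P Y ` Collect (ncompat B P Y)"])
        (auto simp: bij_betw_def inj cin)
    finally show ?thesis
      by (simp add: \<Phi> vhom_ncocone[OF B P Y] cin)
  qed
  note key = this
  show ?thesis
  \<comment> \<open>If \<open>\<mu>\<close> is no cocone with vertex in \<open>B\<close>, both sides
    fail; otherwise \<open>\<mu>\<close> comes from exactly one arrow \<open>m\<close>.\<close>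
  proof (cases "C \<in> Obj B \<and> \<mu> \<in> psh_nat NN Nweight (hom_psh B P C)")
    case True
    then obtain m where m: "ncompat B P C m" "\<mu> = ncocone B P C m"
      using psh_nat_NN[OF B P, of C] by auto
    have eq: "ncocone B P C m = ncocone B P C m' \<longleftrightarrow> m = m'" for m' by (metis ncocone_NO)
    show ?thesis unfolding is_colimit_iff ncolim_def
      using True m(1) key[OF _ _ m(1)] unfolding m(2) eq
      by (simp add: Nweight_def Let_def)
  next
    case False
    then show ?thesis unfolding is_colimit_iff ncolim_def
      using psh_nat_NN[OF B P, of C] by blast
  qed
qed

text \<open>\<open>G\<close> takes the cocone generated by \<open>m\<close> to the cocone generated
  by the image of \<open>m\<close>, so preservation can be tested on the generating arrows.\<close>

lemma preserves_colimit_NN: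
  assumes A: "vv_category A" and B: "vv_category B" and P: "vv_functor NN A P"
    and G: "vv_functor A B G"
  shows "preserves_colimit NN A B Nweight P G \<longleftrightarrow>
    (\<forall>C m. ncolim A P C m \<longrightarrow> ncolim B (vv_comp G P) (Fo G C) (Fm G (Fo P NO) C m))"
proof -
  have e: "(\<lambda>k\<in>Obj NN. \<lambda>w\<in>vob (Fo Nweight k). Fm G (Fo P k) C (ncocone A P C m k w)) =
      ncocone B (vv_comp G P) (Fo G C) (Fm G (Fo P NO) C m)" if n: "ncolim A P C m" for C m
  proof (intro ext)
    fix k i
    have "Fm G (Fo P (NR r)) C (Cmp A (Fo P (NR r)) (Fo P NO) C m (Fm P (NR r) NO x)) =
       Cmp B (Fo G (Fo P (NR r))) (Fo G (Fo P NO)) (Fo G C) (Fm G (Fo P NO) C m)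
         (Fm G (Fo P (NR r)) (Fo P NO) (Fm P (NR r) NO x))" if "x \<noteq> NId" for r x
      by (intro Fm_Cmp[OF G] Fo_in[OF P] Fm_in[OF P])
        (use n that in \<open>auto simp: ncolim_def ncompat_def\<close>)
    then show "(\<lambda>k\<in>Obj NN. \<lambda>w\<in>vob (Fo Nweight k). Fm G (Fo P k) C (ncocone A P C m k w)) k i =
      ncocone B (vv_comp G P) (Fo G C) (Fm G (Fo P NO) C m) k i"
      by (cases k) (auto simp: Nweight_def ncocone_def restrict_def)
  qed
  have eq: "ncocone B Q D x = ncocone B Q D y \<longleftrightarrow> x = y" for Q D x y by (metis ncocone_NO)
  show ?thesis
    unfolding preserves_colimit_def is_colimit_NN[OF A P] is_colimit_NN[OF B vv_functor_comp[OF P G]]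
  proof (intro iffI allI impI)
    fix C m
    assume *: "\<forall>C \<mu>. (\<exists>m. \<mu> = ncocone A P C m \<and> ncolim A P C m) \<longrightarrow>
      (\<exists>m. (\<lambda>k\<in>Obj NN. \<lambda>w\<in>vob (Fo Nweight k). Fm G (Fo P k) C (\<mu> k w))
          = ncocone B (vv_comp G P) (Fo G C) m \<and> ncolim B (vv_comp G P) (Fo G C) m)"
      and n: "ncolim A P C m"
    show "ncolim B (vv_comp G P) (Fo G C) (Fm G (Fo P NO) C m)"
      using *[rule_format, of "ncocone A P C m" C] n unfolding e[OF n] eq by blast
  next
    fix C \<mu>
    assume *: "\<forall>C m. ncolim A P C m \<longrightarrow> ncolim B (vv_comp G P) (Fo G C) (Fm G (Fo P NO) C m)"
      and "\<exists>m. \<mu> = ncocone A P C m \<and> ncolim A P C m"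
    then obtain m where n: "ncolim A P C m" and \<mu>: "\<mu> = ncocone A P C m" by blast
    show "\<exists>m. (\<lambda>k\<in>Obj NN. \<lambda>w\<in>vob (Fo Nweight k). Fm G (Fo P k) C (\<mu> k w))
          = ncocone B (vv_comp G P) (Fo G C) m \<and> ncolim B (vv_comp G P) (Fo G C) m"
      unfolding \<mu> e[OF n] using *[rule_format, OF n] by blast
  qed
qed

section \<open>Discrete \<open>\<V>\<close>-categories\<close>

lemma VCAT_simps [simp]:
  "X \<in> Obj (VCAT U) \<longleftrightarrow> vcategory X \<and> vob X \<in> U" "Hm (VCAT U) = vexp"
  "Cmp (VCAT U) X Y Z g f = compose (vob X) g f" "Idn (VCAT U) X = restrict id (vob X)"
  by (simp_all add: VCAT_def)

lemma SET_simps [simp]: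
  "Obj (SET U) = U" "Hm (SET U) S T = vdisc (S \<rightarrow>\<^sub>E T)"
  "Cmp (SET U) S T R g f = compose S g f" "Idn (SET U) S = restrict id S"
  by (simp_all add: SET_def free_vv_def)

lemma vob_vdisc [simp]: "vob (vdisc S) = S"
  by (simp add: vdisc_def)

lemma Dfun_simps [simp]: "Fo Dfun S = vdisc S" "Fm Dfun S T f = f"
  by (simp_all add: Dfun_def)

lemma Fo_NF [simp]:
  "Fo (NF pr X) NO = vob X"
  "Fo (NF pr X) (NR r) = pr ` {(x', x). x' \<in> vob X \<and> x \<in> vob X \<and> r \<le> vhom X x' x}"
  by (simp_all add: NF_def NF_ob_def)

lemma vfunctors_PiE: "f \<in> vfunctors X Y \<Longrightarrow> f \<in> vob X \<rightarrow>\<^sub>E vob Y"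
  by (simp add: vfunctors_def vfunctor_def PiE_def Pi_def)

section \<open>The diagrams \<open>D F_X\<close> and their colimits\<close>

context universe
begin

lemma inv_pr [simp]: "inv pr (pr p) = p"
  using inj_pr by simp

lemma Fm_NF:
  "Fm (NF pr X) (NR r) NO Delta0 = (\<lambda>p\<in>Fo (NF pr X) (NR r). fst (inv pr p))"
  "Fm (NF pr X) (NR r) NO Delta1 = (\<lambda>p\<in>Fo (NF pr X) (NR r). snd (inv pr p))"
  by (simp_all add: NF_def)

lemma D_NF_functor:
  assumes "X \<in> Obj (VCAT U :: (('u,'v::commutative_quantale) vcat, _, 'v) vvcat)"
  shows "vv_functor NN (VCAT U :: (('u,'v) vcat, _, 'v) vvcat) (vv_comp Dfun (NF pr X))"
  by (rule vv_functor_comp[OF NF_functor[OF assms] D_functor])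

text \<open>A distance in \<open>[D X_r, Y]\<close> is a meet over \<open>X_r\<close>, so the
  condition at \<open>r\<close> says that every pair at distance at least \<open>r\<close> is sent
  to a pair at distance at least \<open>r\<close>. Over all \<open>r\<close> this is
  V-functoriality.\<close>

lemma ncompat_D:
  fixes X Y :: "('u, 'v::commutative_quantale) vcat"
  assumes Y: "vcategory Y"
  shows "ncompat (VCAT U) (vv_comp Dfun (NF pr X)) Y \<phi> \<longleftrightarrow> \<phi> \<in> vfunctors X Y"
proof (cases "\<phi> \<in> vob X \<rightarrow>\<^sub>E vob Y")
  case True
  let ?R = "\<lambda>r. Fo (NF pr X) (NR r)"
  have 1: "compose (?R r) \<phi> (\<lambda>p\<in>?R r. fst (inv pr p)) \<in> vfunctors (vdisc (?R r)) Y"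
    "compose (?R r) \<phi> (\<lambda>p\<in>?R r. snd (inv pr p)) \<in> vfunctors (vdisc (?R r)) Y" for r
    using True by (auto simp: vf_disc2[OF Y] compose_def PiE_def Pi_def)
  have 2: "vhom (vexp (vdisc (?R r)) Y) (compose (?R r) \<phi> (\<lambda>p\<in>?R r. fst (inv pr p)))
      (compose (?R r) \<phi> (\<lambda>p\<in>?R r. snd (inv pr p))) =
      (INF p\<in>?R r. vhom Y (\<phi> (fst (inv pr p))) (\<phi> (snd (inv pr p))))" for r
    unfolding vhom_vexp[OF 1] by (simp add: compose_def del: Fo_NF(2))
  have "ncompat (VCAT U) (vv_comp Dfun (NF pr X)) Y \<phi> \<longleftrightarrow>
    (\<forall>r. \<forall>p\<in>?R r. r \<le> vhom Y (\<phi> (fst (inv pr p))) (\<phi> (snd (inv pr p))))"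
    unfolding ncompat_def using True
    by (simp add: vf_disc2[OF Y] Fm_NF 2 le_INF_iff del: Fo_NF(2))
  \<comment> \<open>Left to right, take \<open>r = vhom X x' x\<close> and the code of the pair
    \<open>(x', x)\<close>.\<close>
  also have "\<dots> \<longleftrightarrow> (\<forall>x'\<in>vob X. \<forall>x\<in>vob X. vhom X x' x \<le> vhom Y (\<phi> x') (\<phi> x))"
    by (auto intro: order_trans)
  finally show ?thesis using True by (auto simp: vfunctors_def vfunctor_def PiE_def)
next
  case False
  then show ?thesis
    using vfunctors_PiE by (auto simp: ncompat_def vf_disc2[OF Y])
qed

lemma Collect_ncompat_D:
  fixes X Y :: "('u, 'v::commutative_quantale) vcat"
  shows "vcategory Y \<Longrightarrow> Collect (ncompat (VCAT U) (vv_comp Dfun (NF pr X)) Y) = vfunctors X Y"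
  by (simp add: set_eq_iff ncompat_D)

text \<open>Composing with the identity map \<open>D X_o -> X\<close> leaves the underlying function
  unchanged, and distances in \<open>[X, Y]\<close> and in \<open>[D X_o, Y]\<close> are meets over
  the same set of objects.\<close>

lemma ncolim_D_id:
  fixes X :: "('u, 'v::commutative_quantale) vcat"
  assumes X: "X \<in> Obj (VCAT U)"
  shows "ncolim (VCAT U) (vv_comp Dfun (NF pr X)) X (restrict id (vob X))"
proof -
  have id: "compose (vob X) g (restrict id (vob X)) = g" if "g \<in> vfunctors X Y" for g and Y :: "('u, 'v) vcat"
    using that by (auto simp: vfunctors_def compose_def extensional_def)
  have d: "vhom (vexp (vdisc (vob X)) Y) g g' = vhom (vexp X Y) g g'"
    if "g \<in> vfunctors X Y" "g' \<in> vfunctors X Y" "vcategory Y" for g g' and Y :: "('u, 'v) vcat"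
  proof -
    have "f \<in> vfunctors (vdisc (vob X)) Y" if "f \<in> vfunctors X Y" for f
      using vfunctors_PiE[OF that] by (simp add: vf_disc2[OF \<open>vcategory Y\<close>])
    then show ?thesis using that by (simp add: vhom_vexp)
  qed
  have bij: "bij_betw (\<lambda>g. compose (vob X) g (restrict id (vob X))) (vfunctors X Y) (vfunctors X Y)"
    for Y :: "('u, 'v) vcat"
    using bij_betw_cong[of "vfunctors X Y" "\<lambda>g. compose (vob X) g (restrict id (vob X))" id] id
    by (metis bij_betw_id id_apply)
  show ?thesis
    unfolding ncolim_def using X
    by (auto simp: ncompat_D id d id_vfunctors Collect_ncompat_D bij)
qed

text \<open>Compatible arrows into \<open>X\<close> include the identity of \<open>X\<close>, so the
  universal property of \<open>C\<close> yields a retraction of \<open>m\<close>, and uniqueness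
  makes it an inverse.\<close>

lemma ncolim_D_iso:
  fixes X C :: "('u, 'v::commutative_quantale) vcat"
  assumes X: "X \<in> Obj (VCAT U)" and n: "ncolim (VCAT U) (vv_comp Dfun (NF pr X)) C m"
  obtains i where "m \<in> vfunctors X C" "i \<in> vfunctors C X"
    "\<And>x. x \<in> vob X \<Longrightarrow> i (m x) = x" "\<And>c. c \<in> vob C \<Longrightarrow> m (i c) = c"
proof -
  have C: "C \<in> Obj (VCAT U)" using n by (simp add: ncolim_def)
  then have "vcategory C" by simp
  then have m: "m \<in> vfunctors X C" using n ncompat_D[of C X m] unfolding ncolim_def by blast
  have bij: "bij_betw (\<lambda>g. compose (vob X) g m) (vfunctors C Y) (vfunctors X Y)"
    if "Y \<in> Obj (VCAT U)" for Y :: "('u, 'v) vcat"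
  proof -
    have "bij_betw (\<lambda>g. compose (vob X) g m) (vfunctors C Y)
      (Collect (ncompat (VCAT U) (vv_comp Dfun (NF pr X)) Y))"
      using n that unfolding ncolim_def by simp
    then show ?thesis using that by (simp add: Collect_ncompat_D)
  qed
  \<comment> \<open>Existence in the universal property, with \<open>X\<close> as the test
    object.\<close>
  obtain i where i: "i \<in> vfunctors C X" and im: "compose (vob X) i m = restrict id (vob X)"
    using bij_betw_imp_surj_on[OF bij[OF X]] id_vfunctors[of X] by (metis imageE)
  have im': "i (m x) = x" if "x \<in> vob X" for x
    using fun_cong[OF im, of x] that by (simp add: compose_def)
  have "compose (vob X) (compose (vob C) m i) m = compose (vob X) (restrict id (vob C)) m"
    using m im' by (auto simp: compose_def vfunctors_def vfunctor_def)
  \<comment> \<open>Uniqueness, with \<open>C\<close> as the test object: \<open>m i\<close> and the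
    identity of \<open>C\<close> agree after composition with \<open>m\<close>.\<close>
  then have mi: "compose (vob C) m i = restrict id (vob C)"
    using inj_onD[OF bij_betw_imp_inj_on[OF bij[OF C]]] compose_vfunctors[OF i m] id_vfunctors[of C]
    by blast
  have "m (i c) = c" if "c \<in> vob C" for c
    using fun_cong[OF mi, of c] that by (simp add: compose_def)
  then show ?thesis using that m i im' by blast
qed

end

section \<open>Left Kan extensions\<close>

text \<open>Precomposition with \<open>i\<close> and with \<open>j\<close> are mutually inverse maps
  that do not decrease distances, hence isomorphisms of homs. The comparison map of
  \<open>C'\<close> is that of \<open>C\<close> after precomposition with \<open>i\<close>.\<close>

lemma is_colimit_iso:
  assumes A: "vv_category A" and F: "\<And>k. k \<in> Obj K \<Longrightarrow> Fo F k \<in> Obj A"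
    and c: "is_colimit K A W F C \<mu>" and C': "C' \<in> Obj A"
    and i: "i \<in> vob (Hm A C C')" and j: "j \<in> vob (Hm A C' C)"
    and ji: "Cmp A C C' C j i = Idn A C" and ij: "Cmp A C' C C' i j = Idn A C'"
  shows "is_colimit K A W F C' (\<lambda>k\<in>Obj K. \<lambda>w\<in>vob (Fo W k). Cmp A (Fo F k) C C' i (\<mu> k w))"
    (is "is_colimit K A W F C' ?\<nu>")
proof -
  let ?\<Phi> = "\<lambda>C \<mu> Y g. \<lambda>k\<in>Obj K. \<lambda>w\<in>vob (Fo W k). Cmp A (Fo F k) C Y g (\<mu> k w)"
  have C: "C \<in> Obj A" using c by (simp add: is_colimit_def)
  have v: "viso (Hm A C Y) (psh_hom K W (hom_psh A F Y)) (?\<Phi> C \<mu> Y)" if "Y \<in> Obj A" for Y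
    using c that unfolding is_colimit_def by blast
  have \<mu>: "\<mu> k w \<in> vob (Hm A (Fo F k) C)" if "k \<in> Obj K" "w \<in> vob (Fo W k)" for k w
    using c that
    by (auto simp: is_colimit_def psh_hom_def psh_nat_def hom_psh_def vfunctors_def vfunctor_def)
  have "viso (Hm A C' Y) (psh_hom K W (hom_psh A F Y)) (?\<Phi> C' ?\<nu> Y)" if Y: "Y \<in> Obj A" for Y
  proof -
    let ?i = "\<lambda>g. Cmp A C C' Y g i" and ?j = "\<lambda>g. Cmp A C' C Y g j"
    have 1: "?\<Phi> C' ?\<nu> Y g = ?\<Phi> C \<mu> Y (?i g)" if "g \<in> vob (Hm A C' Y)" for g
      using Cmp_assoc[OF A F C C' Y \<mu> i that] by (auto simp: restrict_def fun_eq_iff)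
    have iin: "?i g \<in> vob (Hm A C Y)" if "g \<in> vob (Hm A C' Y)" for g
      by (rule Cmp_in[OF A C C' Y i that])
    have jin: "?j g \<in> vob (Hm A C' Y)" if "g \<in> vob (Hm A C Y)" for g
      by (rule Cmp_in[OF A C' C Y j that])
    have ji': "?j (?i g) = g" if "g \<in> vob (Hm A C' Y)" for g
      using Cmp_assoc[OF A C' C C' Y j i that] Cmp_Idn_right[OF A C' Y that] by (simp add: ij)
    have ij': "?i (?j g) = g" if "g \<in> vob (Hm A C Y)" for g
      using Cmp_assoc[OF A C C' C Y i j that] Cmp_Idn_right[OF A C Y that] by (simp add: ji)
    have b: "bij_betw ?i (vob (Hm A C' Y)) (vob (Hm A C Y))"
      by (rule bij_betw_byWitness[of _ ?j]) (use iin jin ji' ij' in auto)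
    have d: "vhom (Hm A C Y) (?i g) (?i g') = vhom (Hm A C' Y) g g'"
      if "g \<in> vob (Hm A C' Y)" "g' \<in> vob (Hm A C' Y)" for g g'
      using vhom_precomp[OF A C C' Y i that] vhom_precomp[OF A C' C Y j iin[OF that(1)] iin[OF that(2)]]
      by (simp add: ji' that antisym)
    have "viso (Hm A C' Y) (Hm A C Y) ?i" using b d by (simp add: viso_iff)
    then show ?thesis by (rule viso_comp[OF _ v[OF Y]]) (rule 1)
  qed
  \<comment> \<open>The new unit is the image of \<open>i\<close> under the comparison map of
    \<open>C\<close> with test object \<open>C'\<close>.\<close>
  moreover have "?\<nu> \<in> vob (psh_hom K W (hom_psh A F C'))"
    by (rule bij_betw_apply[OF conjunct1[OF v[OF C', unfolded viso_iff]] i])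
  ultimately show ?thesis unfolding is_colimit_def by (intro conjI ballI C')
qed

text \<open>The new unit is \<open>\<eta>\<close> followed by \<open>\<beta> : L -> G\<close>.
  Naturality of \<open>\<beta>\<close> identifies the colimit cocones it induces with those
  transported along the isomorphisms \<open>\<beta> c\<close>.\<close>

lemma is_left_Kan_iso:
  assumes B: "vv_category B" and J: "vv_functor A C J" and H: "vv_functor A B H"
    and k: "is_left_Kan A C B J H L \<eta>" and G: "vv_functor C B G"
    and iso: "vv_isomorphic C B G L"
  obtains \<eta>' where "is_left_Kan A C B J H G \<eta>'"
proof -
  have L: "vv_functor C B L" and \<eta>: "vv_natural A B H (vv_comp L J) \<eta>"
    and col: "\<And>c. c \<in> Obj C \<Longrightarrow> is_colimit A B (hom_psh C J c) H (Fo L c)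
        (\<lambda>a\<in>Obj A. \<lambda>f\<in>vob (Hm C (Fo J a) c).
           Cmp B (Fo H a) (Fo L (Fo J a)) (Fo L c) (Fm L (Fo J a) c f) (\<eta> a))"
    using k by (auto simp: is_left_Kan_def)
  obtain \<alpha> \<beta> where \<alpha>: "vv_natural C B G L \<alpha>" and \<beta>: "vv_natural C B L G \<beta>"
    and inv: "\<And>c. c \<in> Obj C \<Longrightarrow> Cmp B (Fo G c) (Fo L c) (Fo G c) (\<beta> c) (\<alpha> c) = Idn B (Fo G c)"
      "\<And>c. c \<in> Obj C \<Longrightarrow> Cmp B (Fo L c) (Fo G c) (Fo L c) (\<alpha> c) (\<beta> c) = Idn B (Fo L c)"
    using iso by (auto simp: vv_isomorphic_def)
  have \<alpha>_in: "\<alpha> c \<in> vob (Hm B (Fo G c) (Fo L c))" and \<beta>_in: "\<beta> c \<in> vob (Hm B (Fo L c) (Fo G c))"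
    if "c \<in> Obj C" for c using \<alpha> \<beta> that by (auto simp: vv_natural_def)
  have \<beta>_nat: "Cmp B (Fo L c) (Fo L d) (Fo G d) (\<beta> d) (Fm L c d f)
     = Cmp B (Fo L c) (Fo G c) (Fo G d) (Fm G c d f) (\<beta> c)"
    if "c \<in> Obj C" "d \<in> Obj C" "f \<in> vob (Hm C c d)" for c d f
    using \<beta> that by (auto simp: vv_natural_def)
  have \<eta>_in: "\<eta> a \<in> vob (Hm B (Fo H a) (Fo L (Fo J a)))" if "a \<in> Obj A" for a
    using \<eta> that by (auto simp: vv_natural_def)
  note ob = Fo_in[OF J] Fo_in[OF L] Fo_in[OF G] Fo_in[OF H]
  let ?\<eta> = "\<lambda>a. Cmp B (Fo H a) (Fo L (Fo J a)) (Fo G (Fo J a)) (\<beta> (Fo J a)) (\<eta> a)"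
  have e: "Cmp B (Fo H a) (Fo L c) (Fo G c) (\<beta> c)
        (Cmp B (Fo H a) (Fo L (Fo J a)) (Fo L c) (Fm L (Fo J a) c f) (\<eta> a))
      = Cmp B (Fo H a) (Fo G (Fo J a)) (Fo G c) (Fm G (Fo J a) c f) (?\<eta> a)"
    if "a \<in> Obj A" "c \<in> Obj C" "f \<in> vob (Hm C (Fo J a) c)" for a c f
  proof -
    note t = that ob \<eta>_in \<beta>_in Fm_in[OF L] Fm_in[OF G]
    have "Cmp B (Fo H a) (Fo L c) (Fo G c) (\<beta> c)
        (Cmp B (Fo H a) (Fo L (Fo J a)) (Fo L c) (Fm L (Fo J a) c f) (\<eta> a))
      = Cmp B (Fo H a) (Fo L (Fo J a)) (Fo G c)
          (Cmp B (Fo L (Fo J a)) (Fo L c) (Fo G c) (\<beta> c) (Fm L (Fo J a) c f)) (\<eta> a)"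
      by (intro Cmp_assoc[OF B] t)
    also have "\<dots> = Cmp B (Fo H a) (Fo L (Fo J a)) (Fo G c)
          (Cmp B (Fo L (Fo J a)) (Fo G (Fo J a)) (Fo G c) (Fm G (Fo J a) c f) (\<beta> (Fo J a))) (\<eta> a)"
      using \<beta>_nat that ob by simp
    also have "\<dots> = Cmp B (Fo H a) (Fo G (Fo J a)) (Fo G c) (Fm G (Fo J a) c f) (?\<eta> a)"
      by (rule sym, intro Cmp_assoc[OF B] t)
    finally show ?thesis .
  qed
  have "vv_natural A B H (vv_comp G J) ?\<eta>"
    unfolding vv_natural_def vv_comp_simps
  proof (intro conjI ballI)
    show "?\<eta> a \<in> vob (Hm B (Fo H a) (Fo G (Fo J a)))" if "a \<in> Obj A" for a
      by (intro Cmp_in[OF B] ob \<eta>_in \<beta>_in that)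
    fix a b f assume t: "a \<in> Obj A" "b \<in> Obj A" "f \<in> vob (Hm A a b)"
    have "Cmp B (Fo H a) (Fo H b) (Fo G (Fo J b)) (?\<eta> b) (Fm H a b f)
        = Cmp B (Fo H a) (Fo L (Fo J b)) (Fo G (Fo J b)) (\<beta> (Fo J b))
            (Cmp B (Fo H a) (Fo H b) (Fo L (Fo J b)) (\<eta> b) (Fm H a b f))"
      by (rule sym, intro Cmp_assoc[OF B] ob t \<eta>_in \<beta>_in Fm_in[OF H])
    also have "Cmp B (Fo H a) (Fo H b) (Fo L (Fo J b)) (\<eta> b) (Fm H a b f)
        = Cmp B (Fo H a) (Fo L (Fo J a)) (Fo L (Fo J b)) (Fm L (Fo J a) (Fo J b) (Fm J a b f)) (\<eta> a)"
      using \<eta> t by (auto simp: vv_natural_def)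
    also have "Cmp B (Fo H a) (Fo L (Fo J b)) (Fo G (Fo J b)) (\<beta> (Fo J b)) \<dots>
        = Cmp B (Fo H a) (Fo G (Fo J a)) (Fo G (Fo J b)) (Fm G (Fo J a) (Fo J b) (Fm J a b f)) (?\<eta> a)"
      by (intro e ob t Fm_in[OF J])
    finally show "Cmp B (Fo H a) (Fo H b) (Fo G (Fo J b)) (?\<eta> b) (Fm H a b f)
        = Cmp B (Fo H a) (Fo G (Fo J a)) (Fo G (Fo J b)) (Fm G (Fo J a) (Fo J b) (Fm J a b f)) (?\<eta> a)" .
  qed
  moreover have "is_colimit A B (hom_psh C J c) H (Fo G c)
        (\<lambda>a\<in>Obj A. \<lambda>f\<in>vob (Hm C (Fo J a) c).
           Cmp B (Fo H a) (Fo G (Fo J a)) (Fo G c) (Fm G (Fo J a) c f) (?\<eta> a))" if c: "c \<in> Obj C" for c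
  proof -
    have eq: "(\<lambda>a\<in>Obj A. \<lambda>f\<in>vob (Fo (hom_psh C J c) a). Cmp B (Fo H a) (Fo L c) (Fo G c) (\<beta> c)
        ((\<lambda>a\<in>Obj A. \<lambda>f\<in>vob (Hm C (Fo J a) c).
           Cmp B (Fo H a) (Fo L (Fo J a)) (Fo L c) (Fm L (Fo J a) c f) (\<eta> a)) a f)) =
      (\<lambda>a\<in>Obj A. \<lambda>f\<in>vob (Hm C (Fo J a) c).
           Cmp B (Fo H a) (Fo G (Fo J a)) (Fo G c) (Fm G (Fo J a) c f) (?\<eta> a))"
      using e c by (auto simp: restrict_def fun_eq_iff hom_psh_def)
    show ?thesis
      using is_colimit_iso[OF B ob(4) col[OF c] ob(3)[OF c] \<beta>_in[OF c] \<alpha>_in[OF c] inv(2)[OF c] inv(1)[OF c]]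
      unfolding eq by simp
  qed
  ultimately show ?thesis using that[of ?\<eta>] G by (simp add: is_left_Kan_def)
qed

text \<open>Postcomposition with \<open>g\<close> is a V-functor on homs and commutes with the
  restriction maps by associativity; this makes the comparison map well defined.\<close>

lemma psh_nat_Cmp:
  assumes A: "vv_category A" and F: "vv_functor K A F" and C: "C \<in> Obj A" and Y: "Y \<in> Obj A"
    and W: "\<And>k l f w. k \<in> Obj K \<Longrightarrow> l \<in> Obj K \<Longrightarrow> f \<in> vob (Hm K k l) \<Longrightarrow> w \<in> vob (Fo W l) \<Longrightarrow>
      Fm W l k f w \<in> vob (Fo W k)"
    and \<mu>: "\<mu> \<in> psh_nat K W (hom_psh A F C)" and g: "g \<in> vob (Hm A C Y)"
  shows "(\<lambda>k\<in>Obj K. \<lambda>w\<in>vob (Fo W k). Cmp A (Fo F k) C Y g (\<mu> k w)) \<in> psh_nat K W (hom_psh A F Y)"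
proof -
  have v: "\<mu> k \<in> vfunctors (Fo W k) (Hm A (Fo F k) C)" if "k \<in> Obj K" for k
    using \<mu> that by (auto simp: psh_nat_def hom_psh_def)
  have m: "\<mu> k w \<in> vob (Hm A (Fo F k) C)" if "k \<in> Obj K" "w \<in> vob (Fo W k)" for k w
    using v[OF that(1)] that by (auto simp: vfunctors_def vfunctor_def)
  have n: "\<mu> k (Fm W l k f w) = Cmp A (Fo F k) (Fo F l) C (\<mu> l w) (Fm F k l f)"
    if "k \<in> Obj K" "l \<in> Obj K" "f \<in> vob (Hm K k l)" "w \<in> vob (Fo W l)" for k l f w
    using \<mu> that m by (auto simp: psh_nat_def hom_psh_def)
  have "vhom (Fo W k) w w' \<le> vhom (Hm A (Fo F k) Y) (Cmp A (Fo F k) C Y g (\<mu> k w)) (Cmp A (Fo F k) C Y g (\<mu> k w'))"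
    if "k \<in> Obj K" "w \<in> vob (Fo W k)" "w' \<in> vob (Fo W k)" for k w w'
    by (rule order_trans[OF _ vhom_postcomp[OF A Fo_in[OF F] C Y m m g]])
      (use that v[OF that(1)] in \<open>auto simp: vfunctors_def vfunctor_def\<close>)
  then have "(\<lambda>w\<in>vob (Fo W k). Cmp A (Fo F k) C Y g (\<mu> k w)) \<in> vfunctors (Fo W k) (Hm A (Fo F k) Y)"
    if "k \<in> Obj K" for k
    using that Cmp_in[OF A Fo_in[OF F] C Y m g] by (simp add: vfunctors_def vfunctor_def)
  moreover have "Cmp A (Fo F k) C Y g (\<mu> k (Fm W l k f w))
      = Cmp A (Fo F k) (Fo F l) Y (Cmp A (Fo F l) C Y g (\<mu> l w)) (Fm F k l f)"
    if "k \<in> Obj K" "l \<in> Obj K" "f \<in> vob (Hm K k l)" "w \<in> vob (Fo W l)" for k l f w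
    unfolding n[OF that] by (intro Cmp_assoc[OF A] Fo_in[OF F] Fm_in[OF F] C Y m g that)
  ultimately show ?thesis
    using Cmp_in[OF A Fo_in[OF F] C Y m g] W by (simp add: psh_nat_def) (simp add: hom_psh_def)
qed

section \<open>From preservation of colimits to Kan extensions\<close>

context universe
begin

lemma SET_precomp:
  fixes X :: "('u, 'v::commutative_quantale) vcat"
  assumes "vcategory X" "u \<in> S \<rightarrow>\<^sub>E T" "f \<in> vfunctors (vdisc T) X"
  shows "compose S f u \<in> vfunctors (vdisc S) X"
  using assms by (auto simp: vf_disc2 compose_def PiE_def Pi_def)

text \<open>The Kan extension is taken of \<open>G D\<close> with identities as unit. Only the
  colimit of each diagram given by \<open>X\<close> itself has to be preserved, since its generating
  arrow is the identity map \<open>D X_o -> X\<close>.\<close>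

lemma preserves_imp_Kan:
  fixes B :: "('p, 'n, 'v::commutative_quantale) vvcat"
    and G :: "(('u, 'v) vcat, 'u \<Rightarrow> 'u, 'p, 'n) vvfun"
  assumes B: "vv_category B" and G: "vv_functor (VCAT U) B G"
    and n: "\<And>X. X \<in> Obj (VCAT U) \<Longrightarrow> ncolim B (vv_comp G (vv_comp Dfun (NF pr X))) (Fo G X)
        (Fm G (vdisc (vob X)) X (restrict id (vob X)))"
  shows "is_left_Kan (SET U) (VCAT U) B Dfun (vv_comp G Dfun) G (\<lambda>S. Idn B (Fo G (vdisc S)))"
proof -
  let ?V = "VCAT U :: (('u, 'v) vcat, 'u \<Rightarrow> 'u, 'v) vvcat"
  let ?H = "vv_comp G Dfun"
  have D: "vdisc S \<in> Obj ?V" if "S \<in> U" for S using that by (simp add: vcategory_vdisc)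
  have H: "vv_functor (SET U) B ?H" by (rule vv_functor_comp[OF D_functor G])
  have GD: "Fo G (vdisc S) \<in> Obj B" if "S \<in> U" for S by (rule Fo_in[OF G D[OF that]])
  have GD_in: "Fm G (vdisc S) (vdisc T) u \<in> vob (Hm B (Fo G (vdisc S)) (Fo G (vdisc T)))"
    if "S \<in> U" "T \<in> U" "u \<in> S \<rightarrow>\<^sub>E T" for S T u
    by (rule Fm_in[OF G D D]) (use that in \<open>simp_all add: vf_disc\<close>)
  have nat: "vv_natural (SET U) B ?H ?H (\<lambda>S. Idn B (Fo G (vdisc S)))"
    unfolding vv_natural_def using Idn_in[OF B GD] GD_in Cmp_Idn_left[OF B GD GD] Cmp_Idn_right[OF B GD GD]
    by auto
  have "is_colimit (SET U) B (hom_psh ?V Dfun X) ?H (Fo G X)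
        (\<lambda>a\<in>U. \<lambda>f\<in>vfunctors (vdisc a) X.
           Cmp B (Fo G (vdisc a)) (Fo G (vdisc a)) (Fo G X) (Fm G (vdisc a) X f) (Idn B (Fo G (vdisc a))))"
    (is "is_colimit _ _ ?W _ _ ?\<kappa>") if X: "X \<in> Obj ?V" for X
  proof -
    have vX: "vcategory X" and XU: "vob X \<in> U" using X by simp_all
    let ?e = "restrict id (vob X)"
    let ?P = "vv_comp G (vv_comp Dfun (NF pr X))"
    have GX: "Fo G X \<in> Obj B" by (rule Fo_in[OF G X])
    have Gf: "Fm G (vdisc S) X f \<in> vob (Hm B (Fo G (vdisc S)) (Fo G X))"
      if "S \<in> U" "f \<in> vfunctors (vdisc S) X" for S f
      by (rule Fm_in[OF G D X]) (use that in simp_all)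
    have e: "?e \<in> vfunctors (vdisc (vob X)) X" by (simp add: vf_disc2[OF vX])
    have fe: "compose S ?e f = f" if "f \<in> S \<rightarrow>\<^sub>E vob X" for f and S :: "'u set"
      by (rule ext) (use that in \<open>auto simp: compose_def PiE_def extensional_def Pi_def\<close>)
    \<comment> \<open>As the unit consists of identities, the coprojection at \<open>f\<close> is
      the image of \<open>f\<close> under \<open>G\<close>.\<close>
    have \<kappa>: "?\<kappa> = (\<lambda>a\<in>U. \<lambda>f\<in>vfunctors (vdisc a) X. Fm G (vdisc a) X f)"
      using Cmp_Idn_right[OF B GD GX Gf] by (auto simp: restrict_def fun_eq_iff)
    have W: "Fo ?W S = vexp (vdisc S) X" "Fm ?W S T u = (\<lambda>f\<in>vfunctors (vdisc S) X. compose T f u)" for S T u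
      by (simp_all add: hom_psh_def)
    have Gcomp: "Fm G (vdisc S) X (compose S f u) =
        Cmp B (Fo G (vdisc S)) (Fo G (vdisc T)) (Fo G X) (Fm G (vdisc T) X f) (Fm G (vdisc S) (vdisc T) u)"
      if "S \<in> U" "T \<in> U" "u \<in> S \<rightarrow>\<^sub>E T" "f \<in> vfunctors (vdisc T) X" for S T u f
      using Fm_Cmp[OF G D D _ X, of S T u f] that by (simp add: vf_disc)
    have Gle: "vhom (vexp (vdisc S) X) f f' \<le> vhom (Hm B (Fo G (vdisc S)) (Fo G X)) (Fm G (vdisc S) X f) (Fm G (vdisc S) X f')"
      if "S \<in> U" "f \<in> vfunctors (vdisc S) X" "f' \<in> vfunctors (vdisc S) X" for S f f'
      using Fm_le[OF G D X, of S f f'] that by simp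
    have Wfm: "Fm ?W T S u f \<in> vfunctors (vdisc S) X"
      if "u \<in> S \<rightarrow>\<^sub>E T" "f \<in> vfunctors (vdisc T) X" for S T u f
      using SET_precomp[OF vX that] that by (simp add: W)
    have \<kappa>_nat: "?\<kappa> \<in> psh_nat (SET U) ?W (hom_psh B ?H (Fo G X))"
      unfolding \<kappa> using Gle Gf Gcomp Wfm
      by (simp add: psh_nat_def W) (simp add: hom_psh_def vfunctors_def vfunctor_def)
    show ?thesis
      unfolding is_colimit_iff Let_def
    proof (intro conjI ballI)
      fix Y assume Y: "Y \<in> Obj B"
      let ?\<Phi> = "\<lambda>g. \<lambda>k\<in>Obj (SET U :: ('u set, 'u \<Rightarrow> 'u, 'v) vvcat). \<lambda>w\<in>vob (Fo ?W k). Cmp B (Fo ?H k) (Fo G X) Y g (?\<kappa> k w)"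
      let ?c = "\<lambda>g. Cmp B (Fo G (vdisc (vob X))) (Fo G X) Y g (Fm G (vdisc (vob X)) X ?e)"
      have bij: "bij_betw ?c (vob (Hm B (Fo G X) Y)) (Collect (ncompat B ?P Y))"
        and dist: "\<And>g g'. g \<in> vob (Hm B (Fo G X) Y) \<Longrightarrow> g' \<in> vob (Hm B (Fo G X) Y) \<Longrightarrow>
          vhom (Hm B (Fo G (vdisc (vob X))) Y) (?c g) (?c g') = vhom (Hm B (Fo G X) Y) g g'"
        using n[OF X] Y by (simp_all add: ncolim_def)
      have \<Phi>: "?\<Phi> g a f = Cmp B (Fo G (vdisc a)) (Fo G X) Y g (Fm G (vdisc a) X f)"
        if "a \<in> U" "f \<in> vfunctors (vdisc a) X" for g a f
        unfolding \<kappa> using that by (simp add: W)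
      have \<Phi>_nat: "?\<Phi> g \<in> psh_nat (SET U) ?W (hom_psh B ?H Y)" if "g \<in> vob (Hm B (Fo G X) Y)" for g
        by (rule psh_nat_Cmp[OF B H GX Y _ \<kappa>_nat that]) (use Wfm in \<open>auto simp: W(1)\<close>)
      show "bij_betw ?\<Phi> (vob (Hm B (Fo G X) Y)) (psh_nat (SET U) ?W (hom_psh B ?H Y))"
        unfolding bij_betw_def
      proof (intro conjI equalityI subsetI)
        \<comment> \<open>Evaluating the family of \<open>g\<close> at the set \<open>X_o\<close>
          and the map \<open>?e\<close> gives \<open>?c g\<close>, and \<open>?c\<close> is
          injective.\<close>
        show "inj_on ?\<Phi> (vob (Hm B (Fo G X) Y))"
        proof (rule inj_onI)
          fix g g' assume g: "g \<in> vob (Hm B (Fo G X) Y)" "g' \<in> vob (Hm B (Fo G X) Y)" and eq: "?\<Phi> g = ?\<Phi> g'"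
          have "?c g = ?c g'" using \<Phi>[OF XU e, of g] \<Phi>[OF XU e, of g'] eq by metis
          then show "g = g'" using inj_onD[OF bij_betw_imp_inj_on[OF bij]] g by blast
        qed
      next
        fix \<tau> assume "\<tau> \<in> ?\<Phi> ` vob (Hm B (Fo G X) Y)"
        then show "\<tau> \<in> psh_nat (SET U) ?W (hom_psh B ?H Y)" using \<Phi>_nat by blast
      next
        fix \<tau> assume \<tau>: "\<tau> \<in> psh_nat (SET U) ?W (hom_psh B ?H Y)"
        have \<tau>v: "\<tau> S \<in> vfunctors (vexp (vdisc S) X) (Hm B (Fo G (vdisc S)) Y)" if "S \<in> U" for S
          using \<tau> that by (auto simp: psh_nat_def hom_psh_def)
        have \<tau>in: "\<tau> S f \<in> vob (Hm B (Fo G (vdisc S)) Y)" if "S \<in> U" "f \<in> vfunctors (vdisc S) X" for S f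
          using \<tau>v[OF that(1)] that by (auto simp: vfunctors_def[of "vexp _ _"] vfunctor_def[of "vexp _ _"])
        have \<tau>n: "\<tau> S (compose S f u) = Cmp B (Fo G (vdisc S)) (Fo G (vdisc T)) Y (\<tau> T f) (Fm G (vdisc S) (vdisc T) u)"
          if "S \<in> U" "T \<in> U" "u \<in> S \<rightarrow>\<^sub>E T" "f \<in> vfunctors (vdisc T) X" for S T u f
          using \<tau> that \<tau>in[OF that(2,4)] by (auto simp: psh_nat_def W) (simp add: hom_psh_def)
        let ?\<phi> = "\<tau> (vob X) ?e"
        have \<tau>e: "\<tau> S f = Cmp B (Fo G (vdisc S)) (Fo G (vdisc (vob X))) Y ?\<phi> (Fm G (vdisc S) (vdisc (vob X)) f)"
          if "S \<in> U" "f \<in> S \<rightarrow>\<^sub>E vob X" for S f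
          using \<tau>n[OF that(1) XU that(2) e] by (simp add: fe[OF that(2)])
        \<comment> \<open>The identity of \<open>X\<close> is a V-functor; in the form
          \<open>ncompat\<close> this says that the two projections \<open>X_r -> X\<close> have
          distance at least \<open>r\<close>.\<close>
        have c: "ncompat ?V (vv_comp Dfun (NF pr X)) X ?e"
          using vX by (simp add: ncompat_D id_vfunctors)
        have R: "Fo (NF pr X) (NR r) \<in> U" for r using Fo_in[OF NF_functor[OF X], of "NR r"] by simp
        have \<delta>: "Fm (NF pr X) (NR r) NO x \<in> Fo (NF pr X) (NR r) \<rightarrow>\<^sub>E vob X" if "x \<noteq> NId" for r x
          using Fm_in[OF NF_functor[OF X], of "NR r" NO x] that by (simp del: Fo_NF(2))
        have "ncompat B ?P Y ?\<phi>"
          unfolding ncompat_def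
        proof (intro conjI allI)
          show "?\<phi> \<in> vob (Hm B (Fo ?P NO) Y)" using \<tau>in[OF XU e] by simp
          fix r
          let ?R = "Fo (NF pr X) (NR r)"
          let ?d = "Fm (NF pr X) (NR r) NO"
          have dX: "?d x \<in> vfunctors (vdisc ?R) X" if "x \<noteq> NId" for x
            using \<delta>[OF that] by (simp add: vf_disc2[OF vX] del: Fo_NF(2))
          have "r \<le> vhom (vexp (vdisc ?R) X) (compose ?R ?e (?d Delta0)) (compose ?R ?e (?d Delta1))"
            using c by (simp add: ncompat_def del: Fo_NF(2))
          then have "r \<le> vhom (vexp (vdisc ?R) X) (?d Delta0) (?d Delta1)"
            by (simp add: fe[OF \<delta>] del: Fo_NF(2))
          \<comment> \<open>V-functoriality of \<open>\<tau>\<close> at the set \<open>X_r\<close>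
            transfers the bound; \<open>\<tau>e\<close> then expresses both values through
            \<open>?\<phi>\<close>.\<close>
          also have "\<dots> \<le> vhom (Hm B (Fo G (vdisc ?R)) Y) (\<tau> ?R (?d Delta0)) (\<tau> ?R (?d Delta1))"
            using \<tau>v[OF R] dX by (auto simp: vfunctors_def[of "vexp _ _"] vfunctor_def[of "vexp _ _"])
          finally show "r \<le> vhom (Hm B (Fo ?P (NR r)) Y)
            (Cmp B (Fo ?P (NR r)) (Fo ?P NO) Y ?\<phi> (Fm ?P (NR r) NO Delta0))
            (Cmp B (Fo ?P (NR r)) (Fo ?P NO) Y ?\<phi> (Fm ?P (NR r) NO Delta1))"
            by (simp add: \<tau>e[OF R \<delta>] del: Fo_NF(2))
        qed
        then obtain g where g: "g \<in> vob (Hm B (Fo G X) Y)" and cg: "?c g = ?\<phi>"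
          using bij_betw_imp_surj_on[OF bij] by (metis (no_types, lifting) imageE mem_Collect_eq)
        have "?\<Phi> g a f = \<tau> a f" for a f
        proof (cases "a \<in> U \<and> f \<in> vfunctors (vdisc a) X")
          case True
          then have f: "a \<in> U" "f \<in> a \<rightarrow>\<^sub>E vob X" "f \<in> vfunctors (vdisc a) X" by (auto simp: vf_disc2[OF vX])
          have "\<tau> a f = Cmp B (Fo G (vdisc a)) (Fo G (vdisc (vob X))) Y (?c g) (Fm G (vdisc a) (vdisc (vob X)) f)"
            using \<tau>e[OF f(1,2)] by (simp only: cg)
          also have "\<dots> = Cmp B (Fo G (vdisc a)) (Fo G X) Y g (Cmp B (Fo G (vdisc a)) (Fo G (vdisc (vob X))) (Fo G X)
              (Fm G (vdisc (vob X)) X ?e) (Fm G (vdisc a) (vdisc (vob X)) f))"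
            by (rule sym, intro Cmp_assoc[OF B] GD GX Y GD_in Gf g e f XU)
          also have "\<dots> = ?\<Phi> g a f"
            unfolding \<Phi>[OF f(1,3)] using Gcomp[OF f(1) XU f(2) e] by (simp only: fe[OF f(2)])
          finally show ?thesis by simp
        next
          \<comment> \<open>Outside the index set or the weight, both families take the default
            value of extensional functions.\<close>
          case False
          then show ?thesis using \<tau> \<tau>v[of a]
            by (auto simp: psh_nat_def vfunctors_def[of "vexp _ _"] extensional_def W restrict_def)
        qed
        then have "\<tau> = ?\<Phi> g" by (intro ext) simp
        then show "\<tau> \<in> ?\<Phi> ` vob (Hm B (Fo G X) Y)" using g by blast
      qed
      fix g g' assume g: "g \<in> vob (Hm B (Fo G X) Y)" "g' \<in> vob (Hm B (Fo G X) Y)"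
      let ?d = "\<lambda>a. vhom (vexp (Fo ?W a) (Hm B (Fo ?H a) Y)) (?\<Phi> g a) (?\<Phi> g' a)"
      have v: "?\<Phi> g a \<in> vfunctors (vexp (vdisc a) X) (Hm B (Fo G (vdisc a)) Y)"
        if "a \<in> U" "g \<in> vob (Hm B (Fo G X) Y)" for a g
        using \<Phi>_nat[OF that(2)] that(1) by (auto simp: psh_nat_def hom_psh_def)
      have d: "?d a = (INF f\<in>vfunctors (vdisc a) X. vhom (Hm B (Fo G (vdisc a)) Y)
          (Cmp B (Fo G (vdisc a)) (Fo G X) Y g (Fm G (vdisc a) X f))
          (Cmp B (Fo G (vdisc a)) (Fo G X) Y g' (Fm G (vdisc a) X f)))" if "a \<in> U" for a
        using vhom_vexp[OF v[OF that g(1)] v[OF that g(2)]] \<Phi>[OF that] by (simp add: W)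
      show "(INF a\<in>Obj (SET U :: ('u set, 'u \<Rightarrow> 'u, 'v) vvcat). ?d a) = vhom (Hm B (Fo G X) Y) g g'"
      \<comment> \<open>The term at \<open>X_o\<close> and \<open>?e\<close> bounds the meet from
        above by an isometric copy of the distance of \<open>g\<close> and \<open>g'\<close>;
        precomposition bounds every term from below.\<close>
      proof (rule antisym)
        have "(INF a\<in>Obj (SET U :: ('u set, 'u \<Rightarrow> 'u, 'v) vvcat). ?d a) \<le> ?d (vob X)"
          by (rule INF_lower) (simp add: XU)
        also have "\<dots> \<le> vhom (Hm B (Fo G (vdisc (vob X))) Y) (?c g) (?c g')"
          unfolding d[OF XU] by (rule INF_lower[OF e])
        also have "\<dots> = vhom (Hm B (Fo G X) Y) g g'" by (rule dist[OF g])
        finally show "(INF a\<in>Obj (SET U :: ('u set, 'u \<Rightarrow> 'u, 'v) vvcat). ?d a) \<le> vhom (Hm B (Fo G X) Y) g g'" .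
        have "vhom (Hm B (Fo G X) Y) g g' \<le> ?d a" if "a \<in> U" for a
          unfolding d[OF that] by (intro INF_greatest vhom_precomp[OF B GD GX Y Gf g] that)
        then show "vhom (Hm B (Fo G X) Y) g g' \<le> (INF a\<in>Obj (SET U :: ('u set, 'u \<Rightarrow> 'u, 'v) vvcat). ?d a)"
          by (intro INF_greatest) simp
      qed
    qed (use GX \<kappa>_nat in simp_all)
  qed
  then show ?thesis unfolding is_left_Kan_def using G nat by simp
qed

section \<open>From Kan extensions to preservation of colimits\<close>

text \<open>Both \<open>G C\<close> and \<open>G D X_o\<close> are colimits by the Kan property, and
  arrows out of them are compared through their natural families. The inverse \<open>i\<close> of
  \<open>m\<close> lifts maps \<open>D S -> C\<close> to maps \<open>D S -> D X_o\<close>.\<close>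

lemma Kan_imp_preserves:
  fixes B :: "('p, 'n, 'v::commutative_quantale) vvcat"
    and G :: "(('u, 'v) vcat, 'u \<Rightarrow> 'u, 'p, 'n) vvfun"
  assumes B: "vv_category B" and H: "vv_functor (SET U) B H"
    and Kan: "is_left_Kan (SET U) (VCAT U) B Dfun H G \<eta>"
    and X: "X \<in> Obj (VCAT U)" and n: "ncolim (VCAT U) (vv_comp Dfun (NF pr X)) C m"
  shows "ncolim B (vv_comp G (vv_comp Dfun (NF pr X))) (Fo G C) (Fm G (vdisc (vob X)) C m)"
proof -
  let ?V = "VCAT U :: (('u, 'v) vcat, 'u \<Rightarrow> 'u, 'v) vvcat"
  let ?D = "vdisc (vob X) :: ('u, 'v) vcat"
  let ?P = "vv_comp G (vv_comp Dfun (NF pr X))"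
  let ?W = "hom_psh ?V Dfun"
  let ?\<kappa> = "\<lambda>c a f. Cmp B (Fo H a) (Fo G (vdisc a)) (Fo G c) (Fm G (vdisc a) c f) (\<eta> a)"
  have G: "vv_functor ?V B G" and \<eta>: "vv_natural (SET U) B H (vv_comp G Dfun) \<eta>"
    and col: "\<And>c. c \<in> Obj ?V \<Longrightarrow> is_colimit (SET U) B (?W c) H (Fo G c)
        (\<lambda>a\<in>U. \<lambda>f\<in>vfunctors (vdisc a) c. ?\<kappa> c a f)"
    using Kan by (simp_all add: is_left_Kan_def)
  have D: "vdisc S \<in> Obj ?V" if "S \<in> U" for S using that by (simp add: vcategory_vdisc)
  have vX: "vcategory X" and XU: "vob X \<in> U" using X by simp_all
  have C: "C \<in> Obj ?V" using n by (simp add: ncolim_def)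
  then have vC: "vcategory C" by simp
  obtain i where m: "m \<in> vfunctors X C" and i: "i \<in> vfunctors C X"
    and im: "\<And>x. x \<in> vob X \<Longrightarrow> i (m x) = x" and mi: "\<And>c. c \<in> vob C \<Longrightarrow> m (i c) = c"
    using ncolim_D_iso[OF X n] by blast
  have mD: "m \<in> vfunctors ?D C" using vfunctors_PiE[OF m] by (simp add: vf_disc2[OF vC])
  have GO: "Fo G c \<in> Obj B" if "c \<in> Obj ?V" for c by (rule Fo_in[OF G that])
  have GD: "Fo G (vdisc S) \<in> Obj B" if "S \<in> U" for S by (rule GO[OF D[OF that]])
  have HO: "Fo H S \<in> Obj B" if "S \<in> U" for S using Fo_in[OF H, of S] that by simp
  have Gm: "Fm G c d f \<in> vob (Hm B (Fo G c) (Fo G d))"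
    if "c \<in> Obj ?V" "d \<in> Obj ?V" "f \<in> vfunctors c d" for c d f
    by (rule Fm_in[OF G that(1,2)]) (use that in simp)
  have \<eta>_in: "\<eta> a \<in> vob (Hm B (Fo H a) (Fo G (vdisc a)))" if "a \<in> U" for a
    using \<eta> that by (simp add: vv_natural_def)
  have \<kappa>_in: "?\<kappa> c a f \<in> vob (Hm B (Fo H a) (Fo G c))"
    if "a \<in> U" "c \<in> Obj ?V" "f \<in> vfunctors (vdisc a) c" for a c f
    by (intro Cmp_in[OF B] HO GD GO \<eta>_in Gm D that)
  have \<kappa>_post: "?\<kappa> c a (compose a k f) = Cmp B (Fo H a) (Fo G d) (Fo G c) (Fm G d c k) (?\<kappa> d a f)"
    if "a \<in> U" "c \<in> Obj ?V" "d \<in> Obj ?V" "f \<in> vfunctors (vdisc a) d" "k \<in> vfunctors d c" for a c d f k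
  proof -
    have "Fm G (vdisc a) c (compose a k f) = Cmp B (Fo G (vdisc a)) (Fo G d) (Fo G c) (Fm G d c k) (Fm G (vdisc a) d f)"
      using Fm_Cmp[OF G D that(3) _ that(2), of a f k] that by simp
    moreover have "Cmp B (Fo H a) (Fo G d) (Fo G c) (Fm G d c k) (?\<kappa> d a f) =
        Cmp B (Fo H a) (Fo G (vdisc a)) (Fo G c)
          (Cmp B (Fo G (vdisc a)) (Fo G d) (Fo G c) (Fm G d c k) (Fm G (vdisc a) d f)) (\<eta> a)"
      by (intro Cmp_assoc[OF B] HO GD GO \<eta>_in Gm D that)
    ultimately show ?thesis by simp
  qed
  \<comment> \<open>Naturality of the coprojections in the set: \<open>\<kappa>_post\<close>
    combined with naturality of \<open>\<eta>\<close>.\<close>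
  have \<kappa>_pre: "?\<kappa> c a (compose a f u) = Cmp B (Fo H a) (Fo H b) (Fo G c) (?\<kappa> c b f) (Fm H a b u)"
    if t: "a \<in> U" "b \<in> U" "c \<in> Obj ?V" "u \<in> a \<rightarrow>\<^sub>E b" "f \<in> vfunctors (vdisc b) c" for a b c u f
  proof -
    have u: "u \<in> vfunctors (vdisc a) (vdisc b :: ('u, 'v) vcat)" using t by (simp add: vf_disc)
    have Hu: "Fm H a b u \<in> vob (Hm B (Fo H a) (Fo H b))"
      by (rule Fm_in[OF H]) (use t in simp_all)
    have "?\<kappa> c a (compose a f u) = Cmp B (Fo H a) (Fo G (vdisc b)) (Fo G c) (Fm G (vdisc b) c f) (?\<kappa> (vdisc b) a u)"
      by (rule \<kappa>_post[OF t(1,3) D[OF t(2)] u t(5)])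
    also have "?\<kappa> (vdisc b) a u = Cmp B (Fo H a) (Fo H b) (Fo G (vdisc b)) (\<eta> b) (Fm H a b u)"
      using \<eta> t by (simp add: vv_natural_def)
    also have "Cmp B (Fo H a) (Fo G (vdisc b)) (Fo G c) (Fm G (vdisc b) c f) \<dots>
        = Cmp B (Fo H a) (Fo H b) (Fo G c) (?\<kappa> c b f) (Fm H a b u)"
      by (intro Cmp_assoc[OF B] HO GD GO \<eta>_in Gm D Hu t)
    finally show ?thesis .
  qed
  let ?\<Phi> = "\<lambda>c Y g. \<lambda>k\<in>U. \<lambda>w\<in>vfunctors (vdisc k) c. Cmp B (Fo H k) (Fo G c) Y g (?\<kappa> c k w)"
  have \<Phi>_eq: "(\<lambda>k\<in>Obj (SET U :: ('u set, 'u \<Rightarrow> 'u, 'v) vvcat). \<lambda>w\<in>vob (Fo (?W c) k). Cmp B (Fo H k) (Fo G c) Y g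
      ((\<lambda>a\<in>U. \<lambda>f\<in>vfunctors (vdisc a) c. ?\<kappa> c a f) k w)) = ?\<Phi> c Y g" for c Y g
    by (auto simp: restrict_def fun_eq_iff hom_psh_def)
  have bij: "bij_betw (?\<Phi> c Y) (vob (Hm B (Fo G c) Y)) (psh_nat (SET U) (?W c) (hom_psh B H Y))"
    and dist: "\<And>g g'. g \<in> vob (Hm B (Fo G c) Y) \<Longrightarrow> g' \<in> vob (Hm B (Fo G c) Y) \<Longrightarrow>
      (INF k\<in>U. vhom (vexp (vexp (vdisc k) c) (Hm B (Fo H k) Y)) (?\<Phi> c Y g k) (?\<Phi> c Y g' k))
         = vhom (Hm B (Fo G c) Y) g g'"
    if "c \<in> Obj ?V" "Y \<in> Obj B" for c Y
    using col[OF that(1)] that(2) unfolding is_colimit_iff Let_def \<Phi>_eq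
    by (simp_all add: hom_psh_def[of _ Dfun])
  let ?m = "Fm G ?D C m"
  have m_in: "?m \<in> vob (Hm B (Fo G ?D) (Fo G C))" by (rule Gm[OF D[OF XU] C mD])
  have i_in: "compose a i f \<in> vfunctors (vdisc a) ?D" if "f \<in> vfunctors (vdisc a) C" for a f
    using that vfunctors_PiE[OF i] by (auto simp: vf_disc vf_disc2[OF vC] compose_def PiE_def Pi_def)
  have mif: "compose a m (compose a i f) = f" if "f \<in> vfunctors (vdisc a) C" for a f
    by (rule ext) (use that in \<open>auto simp: vf_disc2[OF vC] compose_def PiE_def Pi_def extensional_def mi\<close>)
  have imf: "compose a i (compose a m f) = f" if "f \<in> vfunctors (vdisc a) ?D" for a f
    by (rule ext) (use that in \<open>auto simp: vf_disc compose_def PiE_def Pi_def extensional_def im\<close>)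
  \<comment> \<open>Since \<open>f = m i f\<close>, the coprojection of \<open>G C\<close> at
    \<open>f\<close> passes through \<open>G D X_o\<close>, so the family of \<open>g\<close>
    depends only on \<open>g\<close> composed with \<open>?m\<close>.\<close>
  have fac: "Cmp B (Fo H a) (Fo G C) Y g (?\<kappa> C a f)
      = Cmp B (Fo H a) (Fo G ?D) Y (Cmp B (Fo G ?D) (Fo G C) Y g ?m) (?\<kappa> ?D a (compose a i f))"
    if "Y \<in> Obj B" "g \<in> vob (Hm B (Fo G C) Y)" "a \<in> U" "f \<in> vfunctors (vdisc a) C" for Y g a f
  proof -
    have "?\<kappa> C a f = Cmp B (Fo H a) (Fo G ?D) (Fo G C) ?m (?\<kappa> ?D a (compose a i f))"
      using \<kappa>_post[OF that(3) C D[OF XU] i_in[OF that(4)] mD] by (simp only: mif[OF that(4)])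
    moreover have "Cmp B (Fo H a) (Fo G C) Y g (Cmp B (Fo H a) (Fo G ?D) (Fo G C) ?m (?\<kappa> ?D a (compose a i f))) =
        Cmp B (Fo H a) (Fo G ?D) Y (Cmp B (Fo G ?D) (Fo G C) Y g ?m) (?\<kappa> ?D a (compose a i f))"
      by (intro Cmp_assoc[OF B] HO GO \<kappa>_in D C m_in i_in XU that)
    ultimately show ?thesis by simp
  qed
  have comp: "ncompat B ?P (Fo G C) ?m"
    using ncompat_Fm[OF D_NF_functor[OF X] G C vv_VCAT, of m] n by (simp add: ncolim_def)
  have "bij_betw (\<lambda>g. Cmp B (Fo ?P NO) (Fo G C) Y g ?m) (vob (Hm B (Fo G C) Y)) (Collect (ncompat B ?P Y))"
    and "\<And>g g'. g \<in> vob (Hm B (Fo G C) Y) \<Longrightarrow> g' \<in> vob (Hm B (Fo G C) Y) \<Longrightarrow>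
      vhom (Hm B (Fo ?P NO) Y) (Cmp B (Fo ?P NO) (Fo G C) Y g ?m) (Cmp B (Fo ?P NO) (Fo G C) Y g' ?m)
        = vhom (Hm B (Fo G C) Y) g g'"
    if Y: "Y \<in> Obj B" for Y
  proof -
    let ?c = "\<lambda>g. Cmp B (Fo G ?D) (Fo G C) Y g ?m"
    have c_in: "?c g \<in> vob (Hm B (Fo G ?D) Y)" if "g \<in> vob (Hm B (Fo G C) Y)" for g
      by (intro Cmp_in[OF B] GO D C XU Y m_in that)
    have \<Phi>_v: "?\<Phi> C Y g k \<in> vfunctors (vexp (vdisc k) C) (Hm B (Fo H k) Y)"
      if "g \<in> vob (Hm B (Fo G C) Y)" "k \<in> U" for g k
      using bij_betw_apply[OF bij[OF C Y] that(1)] that(2) unfolding psh_nat_def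
      by (simp add: hom_psh_def)
    have inj: "g = g'" if g: "g \<in> vob (Hm B (Fo G C) Y)" "g' \<in> vob (Hm B (Fo G C) Y)" and eq: "?c g = ?c g'" for g g'
    proof (rule inj_onD[OF bij_betw_imp_inj_on[OF bij[OF C Y]] _ g])
      show "?\<Phi> C Y g = ?\<Phi> C Y g'"
        by (intro restrict_ext) (simp only: fac[OF Y g(1)] fac[OF Y g(2)] eq)
    qed
    have surj: "\<exists>g\<in>vob (Hm B (Fo G C) Y). ?c g = \<phi>" if \<phi>: "ncompat B ?P Y \<phi>" for \<phi>
    proof -
      have \<phi>_in: "\<phi> \<in> vob (Hm B (Fo G ?D) Y)" using \<phi> by (simp add: ncompat_def)
      \<comment> \<open>The family that \<open>\<phi>\<close> would induce on \<open>C\<close> if it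
        extended along \<open>?m\<close>, obtained by lifting \<open>f\<close> along
        \<open>i\<close>.\<close>
      let ?t = "\<lambda>a f. Cmp B (Fo H a) (Fo G ?D) Y \<phi> (?\<kappa> ?D a (compose a i f))"
      let ?\<tau> = "\<lambda>a\<in>U. \<lambda>f\<in>vfunctors (vdisc a) C. ?t a f"
      have t_in: "?t a f \<in> vob (Hm B (Fo H a) Y)" if "a \<in> U" "f \<in> vfunctors (vdisc a) C" for a f
        by (intro Cmp_in[OF B] HO GO D XU Y \<phi>_in \<kappa>_in i_in that)
      have t_le: "vhom (vexp (vdisc a) C) f f' \<le> vhom (Hm B (Fo H a) Y) (?t a f) (?t a f')"
        if a: "a \<in> U" and f: "f \<in> vfunctors (vdisc a) C" "f' \<in> vfunctors (vdisc a) C" for a f f'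
      proof -
        \<comment> \<open>\<open>f\<close> and \<open>f'\<close> are jointly a map into \<open>X\<^sub>r\<close> for \<open>r\<close> their distance, so the condition on \<open>\<phi>\<close> applies.\<close>
        define r where "r = vhom (vexp (vdisc a) C) f f'"
        let ?R = "Fo (NF pr X) (NR r)"
        let ?d = "Fm (NF pr X) (NR r) NO"
        let ?h = "\<lambda>s\<in>a. pr (i (f s), i (f' s))"
        have fs: "f s \<in> vob C" "f' s \<in> vob C" if "s \<in> a" for s
          using f that by (auto simp: vf_disc2[OF vC])
        have "r \<le> vhom X (i (f s)) (i (f' s))" if "s \<in> a" for s
        proof -
          have "r \<le> vhom C (f s) (f' s)"
            unfolding r_def vhom_vexp[OF f] by (rule INF_lower) (use that in simp)
          also have "\<dots> \<le> vhom X (i (f s)) (i (f' s))"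
            using i fs[OF that] by (auto simp: vfunctors_def vfunctor_def)
          finally show ?thesis .
        qed
        moreover have "i (f s) \<in> vob X" "i (f' s) \<in> vob X" if "s \<in> a" for s
          using i fs[OF that] by (auto simp: vfunctors_def vfunctor_def)
        ultimately have h: "?h \<in> a \<rightarrow>\<^sub>E ?R" by auto
        then have hs: "pr (i (f s), i (f' s)) \<in> ?R" if "s \<in> a" for s
          using PiE_mem[OF h that] that by (simp del: Fo_NF(2))
        have dh: "compose a (?d Delta0) ?h = compose a i f" "compose a (?d Delta1) ?h = compose a i f'"
          using hs by (auto simp: Fm_NF compose_def restrict_def fun_eq_iff simp del: Fo_NF(2))
        have RU: "?R \<in> U" using Fo_in[OF NF_functor[OF X], of "NR r"] by simp
        have hv: "?h \<in> vfunctors (vdisc a) (vdisc ?R :: ('u, 'v) vcat)" using h by (simp add: vf_disc del: Fo_NF(2))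
        have dv: "?d x \<in> vfunctors (vdisc ?R) ?D" if "x \<noteq> NId" for x
          using Fm_in[OF NF_functor[OF X], of "NR r" NO x] that by (simp add: vf_disc del: Fo_NF(2))
        have N: "Delta0 \<noteq> NId" "Delta1 \<noteq> NId" by simp_all
        \<comment> \<open>The value of \<open>\<phi>\<close> at a projection after \<open>?h\<close>
          factors through \<open>G D X_r\<close>, where the compatibility of \<open>\<phi>\<close>
          gives its bound.\<close>
        have t: "Cmp B (Fo H a) (Fo G ?D) Y \<phi> (?\<kappa> ?D a (compose a (?d x) ?h)) =
            Cmp B (Fo H a) (Fo G (vdisc ?R)) Y (Cmp B (Fo G (vdisc ?R)) (Fo G ?D) Y \<phi> (Fm G (vdisc ?R) ?D (?d x)))
              (?\<kappa> (vdisc ?R) a ?h)" if "x \<noteq> NId" for x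
          unfolding \<kappa>_post[OF a D[OF XU] D[OF RU] hv dv[OF that]]
          by (intro Cmp_assoc[OF B] HO GO D XU RU Y a \<phi>_in \<kappa>_in hv Gm dv that)
        have "r \<le> vhom (Hm B (Fo G (vdisc ?R)) Y)
           (Cmp B (Fo G (vdisc ?R)) (Fo G ?D) Y \<phi> (Fm G (vdisc ?R) ?D (?d Delta0)))
           (Cmp B (Fo G (vdisc ?R)) (Fo G ?D) Y \<phi> (Fm G (vdisc ?R) ?D (?d Delta1)))"
          using \<phi> by (simp add: ncompat_def del: Fo_NF(2))
        also have "\<dots> \<le> vhom (Hm B (Fo H a) Y) (?t a f) (?t a f')"
          unfolding dh[symmetric] t[OF N(1)] t[OF N(2)]
          by (intro vhom_precomp[OF B] HO GO D XU RU Y a \<kappa>_in hv Cmp_in[OF B] \<phi>_in Gm dv) simp_all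
        finally show ?thesis unfolding r_def .
      qed
      have t_nat: "?t a (compose a f u) = Cmp B (Fo H a) (Fo H b) Y (?t b f) (Fm H a b u)"
        if t: "a \<in> U" "b \<in> U" "u \<in> a \<rightarrow>\<^sub>E b" "f \<in> vfunctors (vdisc b) C" for a b u f
      proof -
        have Hu: "Fm H a b u \<in> vob (Hm B (Fo H a) (Fo H b))"
          by (rule Fm_in[OF H]) (use t in simp_all)
        have "compose a i (compose a f u) = compose a (compose b i f) u"
          using t(3) by (auto simp: compose_def restrict_def fun_eq_iff)
        then have "?\<kappa> ?D a (compose a i (compose a f u))
            = Cmp B (Fo H a) (Fo H b) (Fo G ?D) (?\<kappa> ?D b (compose b i f)) (Fm H a b u)"
          using \<kappa>_pre[OF t(1,2) D[OF XU] t(3) i_in[OF t(4)]] by simp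
        moreover have "Cmp B (Fo H a) (Fo G ?D) Y \<phi>
            (Cmp B (Fo H a) (Fo H b) (Fo G ?D) (?\<kappa> ?D b (compose b i f)) (Fm H a b u))
            = Cmp B (Fo H a) (Fo H b) Y (?t b f) (Fm H a b u)"
          by (intro Cmp_assoc[OF B] HO GO D XU Y \<phi>_in \<kappa>_in i_in Hu t)
        ultimately show ?thesis by simp
      qed
      have "?\<tau> \<in> psh_nat (SET U) (?W C) (hom_psh B H Y)"
        using t_in t_le t_nat
        by (simp add: psh_nat_def, simp add: hom_psh_def vfunctors_def[of "vexp _ _"] vfunctor_def[of "vexp _ _"])
          (use SET_precomp[OF vC] in blast)
      \<comment> \<open>The universal property of \<open>G C\<close> turns the natural family into
        the desired extension of \<open>\<phi>\<close>.\<close>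
      then obtain g where g: "g \<in> vob (Hm B (Fo G C) Y)" and \<Phi>g: "?\<Phi> C Y g = ?\<tau>"
        using bij_betw_imp_surj_on[OF bij[OF C Y]] by (metis (no_types, lifting) imageE)
      have gt: "Cmp B (Fo H a) (Fo G C) Y g (?\<kappa> C a f) = ?t a f"
        if "a \<in> U" "f \<in> vfunctors (vdisc a) C" for a f
        using fun_cong[OF fun_cong[OF \<Phi>g, of a], of f] that by simp
      have mf: "compose a m f \<in> vfunctors (vdisc a) C" if "f \<in> vfunctors (vdisc a) ?D" for a f
        using that vfunctors_PiE[OF m] by (auto simp: vf_disc vf_disc2[OF vC] compose_def PiE_def Pi_def)
      \<comment> \<open>Both arrows start at the colimit \<open>G D X_o\<close>, so it suffices to
        compare them on all maps \<open>f\<close> into \<open>X_o\<close>. There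
        \<open>f = i m f\<close>, and \<open>fac\<close> and \<open>gt\<close> apply to
        \<open>m f\<close>.\<close>
      have "?\<Phi> ?D Y (?c g) = ?\<Phi> ?D Y \<phi>"
      proof (intro restrict_ext)
        fix a f assume a: "a \<in> U" and f: "f \<in> vfunctors (vdisc a) ?D"
        show "Cmp B (Fo H a) (Fo G ?D) Y (?c g) (?\<kappa> ?D a f) = Cmp B (Fo H a) (Fo G ?D) Y \<phi> (?\<kappa> ?D a f)"
          using fac[OF Y g a mf[OF f]] gt[OF a mf[OF f]] by (simp only: imf[OF f])
      qed
      then have "?c g = \<phi>"
        by (rule inj_onD[OF bij_betw_imp_inj_on[OF bij[OF D[OF XU] Y]] _ c_in[OF g] \<phi>_in])
      then show ?thesis using g by blast
    qed
    have P: "vv_functor NN B ?P" by (rule vv_functor_comp[OF D_NF_functor[OF X] G])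
    have c_compat: "ncompat B ?P Y (?c g)" if "g \<in> vob (Hm B (Fo G C) Y)" for g
      using ncompat_Cmp[OF B P GO[OF C] Y comp that] by simp
    have "bij_betw ?c (vob (Hm B (Fo G C) Y)) (Collect (ncompat B ?P Y))"
      unfolding bij_betw_def
    proof (intro conjI equalityI subsetI)
      show "inj_on ?c (vob (Hm B (Fo G C) Y))" by (rule inj_onI) (rule inj)
    next
      fix \<phi> assume "\<phi> \<in> ?c ` vob (Hm B (Fo G C) Y)"
      then show "\<phi> \<in> Collect (ncompat B ?P Y)" using c_compat by blast
    next
      fix \<phi> assume "\<phi> \<in> Collect (ncompat B ?P Y)"
      then show "\<phi> \<in> ?c ` vob (Hm B (Fo G C) Y)" using surj[of \<phi>] by blast
    qed
    then show "bij_betw (\<lambda>g. Cmp B (Fo ?P NO) (Fo G C) Y g ?m) (vob (Hm B (Fo G C) Y)) (Collect (ncompat B ?P Y))"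
      by simp
    fix g g' assume g: "g \<in> vob (Hm B (Fo G C) Y)" "g' \<in> vob (Hm B (Fo G C) Y)"
    have "vhom (Hm B (Fo G ?D) Y) (?c g) (?c g') = vhom (Hm B (Fo G C) Y) g g'"
    proof (rule antisym)
      show "vhom (Hm B (Fo G C) Y) g g' \<le> vhom (Hm B (Fo G ?D) Y) (?c g) (?c g')"
        by (intro vhom_precomp[OF B] GO D XU C Y m_in g)
      \<comment> \<open>By \<open>fac\<close>, every component of the family of \<open>g\<close> is
        \<open>?c g\<close> precomposed with a fixed arrow; the Kan property recovers the distance
        of \<open>g\<close> and \<open>g'\<close> as the meet of such terms.\<close>
      have le: "vhom (Hm B (Fo G ?D) Y) (?c g) (?c g') \<le> vhom (Hm B (Fo H a) Y)
          (Cmp B (Fo H a) (Fo G C) Y g (?\<kappa> C a f)) (Cmp B (Fo H a) (Fo G C) Y g' (?\<kappa> C a f))"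
        if "a \<in> U" "f \<in> vfunctors (vdisc a) C" for a f
        unfolding fac[OF Y g(1) that] fac[OF Y g(2) that]
        by (intro vhom_precomp[OF B] HO GO D XU Y \<kappa>_in i_in c_in g that)
      show "vhom (Hm B (Fo G ?D) Y) (?c g) (?c g') \<le> vhom (Hm B (Fo G C) Y) g g'"
        unfolding dist[OF C Y g, symmetric]
      proof (rule INF_greatest)
        fix a assume a: "a \<in> U"
        show "vhom (Hm B (Fo G ?D) Y) (?c g) (?c g') \<le>
            vhom (vexp (vexp (vdisc a) C) (Hm B (Fo H a) Y)) (?\<Phi> C Y g a) (?\<Phi> C Y g' a)"
          unfolding vhom_vexp[OF \<Phi>_v[OF g(1) a] \<Phi>_v[OF g(2) a]]
          by (intro INF_greatest) (use a le[OF a] in simp)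
      qed
    qed
    then show "vhom (Hm B (Fo ?P NO) Y) (Cmp B (Fo ?P NO) (Fo G C) Y g ?m) (Cmp B (Fo ?P NO) (Fo G C) Y g' ?m)
        = vhom (Hm B (Fo G C) Y) g g'" by simp
  qed
  then show ?thesis unfolding ncolim_def using GO[OF C] comp by blast
qed

end

section \<open>The equivalence for endofunctors of V-cat\<close>

text \<open>The functor \<open>L\<close> is a chosen left Kan extension of \<open>H\<close>, which
  is determined only up to isomorphism. The injection of the quantale into a member of
  \<open>U\<close> expresses that the quantale is small.\<close>

theorem theorem3p23:
  fixes U :: "'u set set" and pr :: "'u \<times> 'u \<Rightarrow> 'u"
    and G :: "(('u, 'v::commutative_quantale) vcat, 'u \<Rightarrow> 'u, ('u, 'v) vcat, 'u \<Rightarrow> 'u) vvfun"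
  assumes "universe U pr"
    and "\<exists>A\<in>U. (UNIV :: 'v set) \<lesssim> A"
    and "(1 :: 'v) \<noteq> bot"
    and "(1 :: 'v) = top"
    and "vv_functor (VCAT U) (VCAT U) G"
  shows "(\<exists>H L \<eta>. vv_functor (SET U :: (_, _, 'v) vvcat) (VCAT U) H \<and>
            is_left_Kan (SET U) (VCAT U) (VCAT U) Dfun H L \<eta> \<and>
            vv_isomorphic (VCAT U) (VCAT U) G L)
     \<longleftrightarrow> (\<forall>X \<in> Obj (VCAT U :: (('u, 'v) vcat, _, 'v) vvcat).
            preserves_colimit NN (VCAT U) (VCAT U) Nweight (vv_comp Dfun (NF pr X)) G)"
proof -
  interpret universe U pr by fact
  let ?V = "VCAT U :: (('u, 'v) vcat, 'u \<Rightarrow> 'u, 'v) vvcat"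
  note G = assms(5)
  have pres: "preserves_colimit NN ?V ?V Nweight (vv_comp Dfun (NF pr X)) G \<longleftrightarrow>
    (\<forall>C m. ncolim ?V (vv_comp Dfun (NF pr X)) C m \<longrightarrow>
       ncolim ?V (vv_comp G (vv_comp Dfun (NF pr X))) (Fo G C) (Fm G (vdisc (vob X)) C m))"
    if "X \<in> Obj ?V" for X
    using preserves_colimit_NN[OF vv_VCAT vv_VCAT D_NF_functor[OF that] G] by simp
  show ?thesis
  proof
    assume "\<exists>H L \<eta>. vv_functor (SET U :: (_, _, 'v) vvcat) ?V H \<and>
            is_left_Kan (SET U) ?V ?V Dfun H L \<eta> \<and> vv_isomorphic ?V ?V G L"
    then obtain H L \<eta> where H: "vv_functor (SET U) ?V H"
      and L: "is_left_Kan (SET U) ?V ?V Dfun H L \<eta>" and iso: "vv_isomorphic ?V ?V G L" by blast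
    \<comment> \<open>The Kan property passes from \<open>L\<close> to \<open>G\<close>, so that
      preservation is proved for \<open>G\<close> directly.\<close>
    obtain \<eta>' where "is_left_Kan (SET U) ?V ?V Dfun H G \<eta>'"
      by (rule is_left_Kan_iso[OF vv_VCAT D_functor H L G iso])
    then show "\<forall>X \<in> Obj ?V. preserves_colimit NN ?V ?V Nweight (vv_comp Dfun (NF pr X)) G"
      using pres Kan_imp_preserves[OF vv_VCAT H] by blast
  next
    assume "\<forall>X \<in> Obj ?V. preserves_colimit NN ?V ?V Nweight (vv_comp Dfun (NF pr X)) G"
    \<comment> \<open>By \<open>ncolim_D_id\<close>, \<open>X\<close> is a colimit of its own
      diagram, and \<open>G\<close> preserves this one by assumption.\<close>
    then have "is_left_Kan (SET U) ?V ?V Dfun (vv_comp G Dfun) G (\<lambda>S. Idn ?V (Fo G (vdisc S)))"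
      using pres ncolim_D_id by (intro preserves_imp_Kan[OF vv_VCAT G]) blast
    then show "\<exists>H L \<eta>. vv_functor (SET U :: (_, _, 'v) vvcat) ?V H \<and>
            is_left_Kan (SET U) ?V ?V Dfun H L \<eta> \<and> vv_isomorphic ?V ?V G L"
      using vv_functor_comp[OF D_functor G] vv_isomorphic_refl[OF vv_VCAT G] by blast
  qed
qed

end
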